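(* Let $\alpha$ be a virtual string whose based matrix $T(\alpha)$ is primitive. If $T(\alpha)$ does not contain a self-complementary element, then $m([\alpha]) = t(\mu([\alpha]))/2$. If $T(\alpha)$ does contain a self-complementary element, then either $m([\alpha]) = t(\mu([\alpha]))/2$ or $m([\alpha]) = t(\mu([\alpha]))/2+1$.
   Context: Virtual strings. A virtual string $\alpha$ is an oriented circle $S^1$ (the core circle) with a finite set $\mathrm{arr}(\alpha)$ of arrows; an arrow is an ordered pair $(a,b)$ of points of $S^1$ with tail $a$ and head $b$, and all endpoints of arrows are pairwise distinct. Strings are considered up to orientation-preserving homeomorphism of the core circle. For distinct $x,y\in S^1$, $xy$ denotes the arc from $x$ to $y$ in the positive direction and $(xy)^\circ$ its interior. Two virtual strings are (virtually) homotopic if they are related by a finite sequence of the following moves and their inverses. Type 1: if the arc $ab$ contains no endpoints of arrows, add the arrow $(a,b)$ or the arrow $(b,a)$. Type 2: given two disjoint arcs containing no endpoints of arrows, the first with endpoints $a,a'$ (in either order) and the second with endpoints $b,b'$ (in either order), add the two arrows $(a,b)$ and $(b',a')$. Type 3a: given disjoint arcs $aa^+,bb^+,cc^+$ with no arrow endpoints in their interiors, such that $(a^+,b),(b^+,c),(c^+,a)$ are arrows, replace these by $(a,b^+),(b,c^+),(c,a^+)$. Type 3b: given such arcs where $(a,b),(a^+,c),(b^+,c^+)$ are arrows, replace these by $(a^+,b^+),(a,c^+),(b,c)$. The homotopy class of $\alpha$ is $[\alpha]$, and $m([\alpha])$ (minimal self-intersection number) is the minimum of $|\mathrm{arr}(\beta)|$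 over $\beta\in[\alpha]$. Signed singular virtual strings. A signed singular virtual string $\alpha_d^\epsilon$ is a virtual string $\alpha$ with a distinguished arrow $d\in\mathrm{arr}(\alpha)$ and a sign $\epsilon\in\{+,-\}$. Two of them are homotopic if related by a finite sequence of the following moves and inverses: Type 1, 2, 3 moves not involving the distinguished arrow; signed singular Type 2: if $e=(a,b)$ and $e'=(b',a')$ are arrows, where $a,a'$ and $b,b'$ are the endpoints of two disjoint arcs with no arrow endpoints in their interiors, and one of $e,e'$ is distinguished, make the other one distinguished instead and reverse the sign (no arrow is removed); signed singular Type 3: a Type 3a or 3b move in which one of the three arrows is distinguished, the arrow replacing it becomes distinguished, and the sign is kept. The class is written $[\alpha_d^\epsilon]$. A signed singular string is semi-trivial if its distinguished arrow $(a,b)$ is such that $(ab)^\circ$ or $(ba)^\circ$ contains no endpoint of an arrow; a homotopy class is semi-trivial if it contains a semi-trivial signed singular string. The operation $\mu$. Let $\mathcal{S}_0^\Theta$ be the set of homotopy classes of signed singular virtual strings that are not semi-trivial. Put $\mu([\alpha])=\sum_{e\in \mathrm{arr}(\alpha)}\big([\alpha_e^+]-[\alpha_e^-]\big)\in\mathbb{Z}[\mathcal{S}_0^\Theta]$, where semi-trivial classes are set equal to $0$; this depends only on $[\alpha]$. For a reduced linear combination $L=\sum_i a_ie_i$ in a free $\mathbb{Z}$-module with distinct basis elements $e_i$, the number of terms is $t(L)=\sum_i|a_i|$. Based matrices. A based matrix over an abelian group $H$ is a triple $(G,s,b)$ with $G$ a finite set, $s\in G$, and $b:G\times G\to H$ skew-symmetric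 ($b(g,h)=-b(h,g)$, $b(g,g)=0$). An element $g\in G-\{s\}$ is annihilating if $b(g,h)=0$ for all $h\in G$, and core if $b(g,h)=b(s,h)$ for all $h\in G$; two elements $g_1,g_2\in G-\{s\}$ are complementary if $b(g_1,h)+b(g_2,h)=b(s,h)$ for all $h\in G$. The moves $M_1,M_2,M_3$ (elementary extensions) enlarge $(G,s,b)$ to $(\bar G,s,\bar b)$ with $\bar b$ skew-symmetric extending $b$, by adding respectively one annihilating element, one core element, or a pair of complementary elements. A based matrix is primitive if it cannot be obtained from another based matrix by a sequence of $M_i$ moves. An element $g\in G$ is self-complementary if $2b(g,h)=b(s,h)$ for all $h\in G$. The based matrix $T(\alpha)=(G,s,b)$ of a virtual string, over $\mathbb{Z}$: $G=\{s\}\sqcup\mathrm{arr}(\alpha)$. For arrows $e=(a,b)$, $f=(c,d)$, $f$ links $e$ positively if $c\in ab$ and $d\in ba$, and negatively if $c\in ba$ and $d\in ab$; otherwise they are unlinked. Set $b(e,s)=n(e)$, the number of arrows linking $e$ positively minus the number linking $e$ negatively, and $b(e,f)=ab\cdot cd+\sigma$, where $ab\cdot cd$ is the number of arrows with tail in $(ab)^\circ$ and head in $(cd)^\circ$ minus the number with tail in $(cd)^\circ$ and head in $(ab)^\circ$, and $\sigma=0,1,-1$ according as $e,f$ are unlinked, $f$ links $e$ positively, or $f$ links $e$ negatively. The remaining values are determined by skew-symmetry. *)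

theory Defs
  imports "HOL-Analysis.Analysis" "HOL-Library.Poly_Mapping"
begin

section \<open>Virtual strings\<close>

text \<open>The core circle is the unit circle of the complex plane with its counterclockwise
  orientation. An arrow is the pair (tail, head).\<close>

type_synonym arrow = "complex \<times> complex"

abbreviation circle :: "complex set" where
  "circle \<equiv> sphere 0 1"

text \<open>For distinct points x, y of the circle: the arc from x to y in the positive direction,
  with and without its endpoints. The number \<open>Arg2pi (z / x)\<close> in [0, 2 pi) is the positive
  angle from x to z.\<close>

definition circle_arc :: "complex \<Rightarrow> complex \<Rightarrow> complex set" where
  "circle_arc x y = {z \<in> circle. Arg2pi (z / x) \<le> Arg2pi (y / x)}"

definition open_circle_arc :: "complex \<Rightarrow> complex \<Rightarrow> complex set" where
  "open_circle_arc x y = {z \<in> circle. 0 < Arg2pi (z / x) \<and> Arg2pi (z / x) < Arg2pi (y / x)}"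

definition ends :: "arrow \<Rightarrow> complex set" where
  "ends e = {fst e, snd e}"

definition arrow_diagram :: "arrow set \<Rightarrow> bool" where
  "arrow_diagram A \<longleftrightarrow> finite A \<and>
     (\<forall>e\<in>A. ends e \<subseteq> circle \<and> fst e \<noteq> snd e) \<and>
     (\<forall>e\<in>A. \<forall>f\<in>A. e \<noteq> f \<longrightarrow> ends e \<inter> ends f = {})"

typedef vstring = "{A. arrow_diagram A}"
  morphisms arr Abs_vstring
  by (rule exI[of _ "{}"]) (simp add: arrow_diagram_def)

definition endpoints :: "vstring \<Rightarrow> complex set" where
  "endpoints \<alpha> = (\<Union>e\<in>arr \<alpha>. ends e)"

definition oriented_homeo :: "(complex \<Rightarrow> complex) \<Rightarrow> bool" where
  "oriented_homeo h \<longleftrightarrow> (\<exists>k. homeomorphism circle circle h k) \<and>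
     (\<forall>x\<in>circle. \<forall>y\<in>circle. x \<noteq> y \<longrightarrow> h ` circle_arc x y = circle_arc (h x) (h y))"

section \<open>Homotopy of virtual strings\<close>

text \<open>An unordered pair \<open>{a, a'} = {x, y}\<close> below renders that the arc from x to y has endpoints
  \<open>a, a'\<close> in either order.\<close>

inductive type1 :: "vstring \<Rightarrow> vstring \<Rightarrow> bool" where
  "\<lbrakk>a \<in> circle; b \<in> circle; a \<noteq> b; circle_arc a b \<inter> endpoints \<alpha> = {};
    arr \<beta> = insert (a, b) (arr \<alpha>) \<or> arr \<beta> = insert (b, a) (arr \<alpha>)\<rbrakk>
   \<Longrightarrow> type1 \<alpha> \<beta>"

inductive type2 :: "vstring \<Rightarrow> vstring \<Rightarrow> bool" where
  "\<lbrakk>{x, y, z, w} \<subseteq> circle; x \<noteq> y; z \<noteq> w; {a, a'} = {x, y}; {b, b'} = {z, w};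
    circle_arc x y \<inter> circle_arc z w = {};
    circle_arc x y \<inter> endpoints \<alpha> = {}; circle_arc z w \<inter> endpoints \<alpha> = {};
    arr \<beta> = arr \<alpha> \<union> {(a, b), (b', a')}\<rbrakk>
   \<Longrightarrow> type2 \<alpha> \<beta>"

text \<open>Moves of Type 3a and 3b. The second argument is the set of pairs consisting of an arrow
  that takes part in the move and the arrow that replaces it; \<open>p\<close> stands for \<open>a\<^sup>+\<close>, \<open>q\<close> for
  \<open>b\<^sup>+\<close> and \<open>r\<close> for \<open>c\<^sup>+\<close>.\<close>

definition free_arcs :: "vstring \<Rightarrow> complex \<Rightarrow> complex \<Rightarrow> complex \<Rightarrow> complex \<Rightarrow> complex \<Rightarrow> complex \<Rightarrow> bool" where
  "free_arcs \<alpha> a p b q c r \<longleftrightarrow>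
     circle_arc a p \<inter> circle_arc b q = {} \<and> circle_arc b q \<inter> circle_arc c r = {} \<and> circle_arc a p \<inter> circle_arc c r = {} \<and>
     open_circle_arc a p \<inter> endpoints \<alpha> = {} \<and> open_circle_arc b q \<inter> endpoints \<alpha> = {} \<and>
     open_circle_arc c r \<inter> endpoints \<alpha> = {}"

inductive type3 :: "vstring \<Rightarrow> (arrow \<times> arrow) set \<Rightarrow> vstring \<Rightarrow> bool" where
  type3a:
  "\<lbrakk>free_arcs \<alpha> a p b q c r;
    R = {((p, b), (a, q)), ((q, c), (b, r)), ((r, a), (c, p))};
    fst ` R \<subseteq> arr \<alpha>; arr \<beta> = (arr \<alpha> - fst ` R) \<union> snd ` R\<rbrakk>
   \<Longrightarrow> type3 \<alpha> R \<beta>"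
| type3b:
  "\<lbrakk>free_arcs \<alpha> a p b q c r;
    R = {((a, b), (p, q)), ((p, c), (a, r)), ((q, r), (b, c))};
    fst ` R \<subseteq> arr \<alpha>; arr \<beta> = (arr \<alpha> - fst ` R) \<union> snd ` R\<rbrakk>
   \<Longrightarrow> type3 \<alpha> R \<beta>"

inductive vmove :: "vstring \<Rightarrow> vstring \<Rightarrow> bool" where
  vmove_homeo: "\<lbrakk>oriented_homeo h; arr \<beta> = map_prod h h ` arr \<alpha>\<rbrakk> \<Longrightarrow> vmove \<alpha> \<beta>"
| vmove_type1: "type1 \<alpha> \<beta> \<Longrightarrow> vmove \<alpha> \<beta>"
| vmove_type2: "type2 \<alpha> \<beta> \<Longrightarrow> vmove \<alpha> \<beta>"
| vmove_type3: "type3 \<alpha> R \<beta> \<Longrightarrow> vmove \<alpha> \<beta>"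

definition homotopic_strings :: "vstring \<Rightarrow> vstring \<Rightarrow> bool" where
  "homotopic_strings = equivclp vmove"

definition string_class :: "vstring \<Rightarrow> vstring set" where
  "string_class \<alpha> = {\<beta>. homotopic_strings \<alpha> \<beta>}"

definition min_self_intersection :: "vstring set \<Rightarrow> nat" where
  "min_self_intersection C = (LEAST n. \<exists>\<beta>\<in>C. n = card (arr \<beta>))"

section \<open>Signed singular virtual strings\<close>

datatype sign = Plus | Minus

fun opp :: "sign \<Rightarrow> sign" where
  "opp Plus = Minus"
| "opp Minus = Plus"

text \<open>A triple \<open>(\<alpha>, d, \<epsilon>)\<close> in which d is an arrow of \<open>\<alpha>\<close>.\<close>

typedef sstring = "{(\<alpha>, d, \<epsilon> :: sign). d \<in> arr \<alpha>}"
proof -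
  have "arrow_diagram {(1, -1)}"
    by (auto simp: arrow_diagram_def ends_def)
  then have "(1, -1) \<in> arr (Abs_vstring {(1, -1)})"
    by (simp add: Abs_vstring_inverse)
  then show ?thesis by blast
qed

abbreviation sing :: "vstring \<Rightarrow> arrow \<Rightarrow> sign \<Rightarrow> sstring" where
  "sing \<alpha> d \<epsilon> \<equiv> Abs_sstring (\<alpha>, d, \<epsilon>)"

text \<open>In \<open>smove_type1\<close> and \<open>smove_type2\<close> the distinguished arrow is an arrow of the smaller
  string, hence not one of those added. In \<open>smove_type3\<close> it is not among the three arrows that
  are replaced. For \<open>smove_sing2\<close> the arrows \<open>e = (a, b)\<close> and \<open>e' = (b', a')\<close> play symmetric
  roles, as renaming \<open>a, a', b, b'\<close> to \<open>b', b, a', a\<close> exchanges them.\<close>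

inductive smove :: "sstring \<Rightarrow> sstring \<Rightarrow> bool" where
  smove_homeo: "\<lbrakk>oriented_homeo h; arr \<beta> = map_prod h h ` arr \<alpha>; d \<in> arr \<alpha>\<rbrakk>
     \<Longrightarrow> smove (sing \<alpha> d \<epsilon>) (sing \<beta> (map_prod h h d) \<epsilon>)"
| smove_type1: "\<lbrakk>type1 \<alpha> \<beta>; d \<in> arr \<alpha>\<rbrakk> \<Longrightarrow> smove (sing \<alpha> d \<epsilon>) (sing \<beta> d \<epsilon>)"
| smove_type2: "\<lbrakk>type2 \<alpha> \<beta>; d \<in> arr \<alpha>\<rbrakk> \<Longrightarrow> smove (sing \<alpha> d \<epsilon>) (sing \<beta> d \<epsilon>)"
| smove_type3: "\<lbrakk>type3 \<alpha> R \<beta>; d \<in> arr \<alpha>; d \<notin> fst ` R\<rbrakk> \<Longrightarrow> smove (sing \<alpha> d \<epsilon>) (sing \<beta> d \<epsilon>)"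
| smove_sing2: "\<lbrakk>{a, a'} = {x, y}; {b, b'} = {z, w}; circle_arc x y \<inter> circle_arc z w = {};
     open_circle_arc x y \<inter> endpoints \<alpha> = {}; open_circle_arc z w \<inter> endpoints \<alpha> = {};
     (a, b) \<in> arr \<alpha>; (b', a') \<in> arr \<alpha>\<rbrakk>
     \<Longrightarrow> smove (sing \<alpha> (a, b) \<epsilon>) (sing \<alpha> (b', a') (opp \<epsilon>))"
| smove_sing3: "\<lbrakk>type3 \<alpha> R \<beta>; (d, d') \<in> R\<rbrakk> \<Longrightarrow> smove (sing \<alpha> d \<epsilon>) (sing \<beta> d' \<epsilon>)"

definition homotopic_sstrings :: "sstring \<Rightarrow> sstring \<Rightarrow> bool" where
  "homotopic_sstrings = equivclp smove"

definition sstring_class :: "sstring \<Rightarrow> sstring set" where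
  "sstring_class x = {y. homotopic_sstrings x y}"

definition semi_trivial_sstring :: "sstring \<Rightarrow> bool" where
  "semi_trivial_sstring x \<longleftrightarrow> (case Rep_sstring x of (\<alpha>, (a, b), \<epsilon>) \<Rightarrow>
     open_circle_arc a b \<inter> endpoints \<alpha> = {} \<or> open_circle_arc b a \<inter> endpoints \<alpha> = {})"

definition semi_trivial_class :: "sstring set \<Rightarrow> bool" where
  "semi_trivial_class C \<longleftrightarrow> (\<exists>x\<in>C. semi_trivial_sstring x)"

section \<open>The operation mu\<close>

text \<open>The generator of the free abelian group given by a homotopy class, semi-trivial classes
  being set equal to 0.\<close>

definition gen :: "sstring set \<Rightarrow> (sstring set \<Rightarrow>\<^sub>0 int)" where
  "gen C = (if semi_trivial_class C then 0 else frag_of C)"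

definition mu_string :: "vstring \<Rightarrow> (sstring set \<Rightarrow>\<^sub>0 int)" where
  "mu_string \<alpha> = (\<Sum>e\<in>arr \<alpha>. gen (sstring_class (sing \<alpha> e Plus)) - gen (sstring_class (sing \<alpha> e Minus)))"

text \<open>The common value of \<open>mu_string\<close> on a homotopy class of virtual strings; see
  \<open>mu_string_class\<close> below.\<close>

definition mu :: "vstring set \<Rightarrow> (sstring set \<Rightarrow>\<^sub>0 int)" where
  "mu C = the_elem (mu_string ` C)"

text \<open>Invariance of \<open>mu_string\<close> under homotopy.\<close>

lemma homotopic_strings_refl [simp]: "homotopic_strings \<alpha> \<alpha>"
  by (simp add: homotopic_strings_def)

lemma sstring_class_eq: "homotopic_sstrings x y \<Longrightarrow> sstring_class x = sstring_class y"
  unfolding sstring_class_def homotopic_sstrings_def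
  by (auto intro: equivclp_trans equivclp_sym)

lemma smove_class_eq: "smove x y \<Longrightarrow> sstring_class x = sstring_class y"
  by (rule sstring_class_eq) (simp add: homotopic_sstrings_def r_into_equivclp)

lemma arr_diagram: "arrow_diagram (arr \<alpha>)"
  using arr by simp

lemma finite_arr [simp]: "finite (arr \<alpha>)"
  using arr_diagram[of \<alpha>] by (simp add: arrow_diagram_def)

lemma arr_circle: "(x, y) \<in> arr \<alpha> \<Longrightarrow> x \<in> circle \<and> y \<in> circle \<and> x \<noteq> y"
  using arr_diagram[of \<alpha>] by (fastforce simp: arrow_diagram_def ends_def)

lemma arr_disjoint: "\<lbrakk>e \<in> arr \<alpha>; f \<in> arr \<alpha>; z \<in> ends e; z \<in> ends f\<rbrakk> \<Longrightarrow> e = f"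
  using arr_diagram[of \<alpha>] unfolding arrow_diagram_def by blast

lemma endpoints_in: "(x, y) \<in> arr \<alpha> \<Longrightarrow> x \<in> endpoints \<alpha> \<and> y \<in> endpoints \<alpha>"
  by (force simp: endpoints_def ends_def)

lemma circle_arc_ends:
  assumes "x \<in> circle" "y \<in> circle"
  shows "x \<in> circle_arc x y" "y \<in> circle_arc x y"
proof -
  have "x \<noteq> 0" using assms by auto
  then have "Arg2pi (x / x) = 0" by (simp add: Arg2pi_eq_0)
  with assms Arg2pi_ge_0 show "x \<in> circle_arc x y" "y \<in> circle_arc x y"
    by (simp_all add: circle_arc_def)
qed

lemma open_circle_arc_subset: "open_circle_arc x y \<subseteq> circle_arc x y"
  by (auto simp: open_circle_arc_def circle_arc_def)

lemma open_circle_arc_ends: "x \<notin> open_circle_arc x y" "y \<notin> open_circle_arc x y"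
proof -
  have "Arg2pi (x / x) = 0" by (cases "x = 0") (simp_all add: Arg2pi_eq_0)
  then show "x \<notin> open_circle_arc x y" "y \<notin> open_circle_arc x y"
    by (simp_all add: open_circle_arc_def)
qed

definition mu_term :: "vstring \<Rightarrow> arrow \<Rightarrow> (sstring set \<Rightarrow>\<^sub>0 int)" where
  "mu_term \<alpha> e = gen (sstring_class (sing \<alpha> e Plus)) - gen (sstring_class (sing \<alpha> e Minus))"

lemma mu_string_alt: "mu_string \<alpha> = (\<Sum>e\<in>arr \<alpha>. mu_term \<alpha> e)"
  by (simp add: mu_string_def mu_term_def)

lemma mu_term_eq:
  assumes "\<And>\<epsilon>. smove (sing \<alpha> d \<epsilon>) (sing \<beta> d' \<epsilon>)"
  shows "mu_term \<alpha> d = mu_term \<beta> d'"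
  using smove_class_eq[OF assms] by (simp add: mu_term_def)

lemma semi_trivial_gen:
  assumes "(a, b) \<in> arr \<alpha>"
    and "open_circle_arc a b \<inter> endpoints \<alpha> = {} \<or> open_circle_arc b a \<inter> endpoints \<alpha> = {}"
  shows "gen (sstring_class (sing \<alpha> (a, b) \<epsilon>)) = 0"
proof -
  have "semi_trivial_sstring (sing \<alpha> (a, b) \<epsilon>)"
    using assms by (simp add: semi_trivial_sstring_def Abs_sstring_inverse)
  moreover have "sing \<alpha> (a, b) \<epsilon> \<in> sstring_class (sing \<alpha> (a, b) \<epsilon>)"
    by (simp add: sstring_class_def homotopic_sstrings_def)
  ultimately show ?thesis by (auto simp: gen_def semi_trivial_class_def)
qed

lemma mu_string_homeo:
  assumes "oriented_homeo h" "arr \<beta> = map_prod h h ` arr \<alpha>"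
  shows "mu_string \<alpha> = mu_string \<beta>"
proof -
  from assms(1) obtain k where "homeomorphism circle circle h k"
    by (auto simp: oriented_homeo_def)
  then have k: "k (h x) = x" if "x \<in> circle" for x
    using that by (simp add: homeomorphism_def)
  have "inj_on (map_prod h h) (arr \<alpha>)"
  proof (rule inj_onI)
    fix e f assume ef: "e \<in> arr \<alpha>" "f \<in> arr \<alpha>" "map_prod h h e = map_prod h h f"
    obtain x y z w where [simp]: "e = (x, y)" "f = (z, w)" by fastforce
    have "x \<in> circle" "y \<in> circle" "z \<in> circle" "w \<in> circle"
      using ef(1,2) arr_circle by auto
    moreover have "h x = h z" "h y = h w" using ef(3) by auto
    ultimately show "e = f" using k by (metis \<open>e = (x, y)\<close> \<open>f = (z, w)\<close>)
  qed
  then have "mu_string \<beta> = (\<Sum>e\<in>arr \<alpha>. mu_term \<beta> (map_prod h h e))"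
    by (simp add: mu_string_alt assms(2) sum.reindex)
  also have "\<dots> = mu_string \<alpha>"
    unfolding mu_string_alt
    by (intro sum.cong refl sym[OF mu_term_eq] smove_homeo assms)
  finally show ?thesis ..
qed

lemma mu_string_type1:
  assumes "type1 \<alpha> \<beta>"
  shows "mu_string \<alpha> = mu_string \<beta>"
  using assms
proof cases
  case (1 a b)
  have ab: "a \<in> circle_arc a b" "b \<in> circle_arc a b"
    using 1 circle_arc_ends by auto
  obtain e where e: "arr \<beta> = insert e (arr \<alpha>)" "e = (a, b) \<or> e = (b, a)"
    using 1 by auto
  have new: "e \<notin> arr \<alpha>"
    using endpoints_in[of _ _ \<alpha>] ab 1(4) e(2) by blast
  have ep: "endpoints \<beta> = {a, b} \<union> endpoints \<alpha>"
    using e by (auto simp: endpoints_def ends_def)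
  have "open_circle_arc a b \<inter> {a, b} = {}"
    using open_circle_arc_ends by auto
  moreover have "open_circle_arc a b \<inter> endpoints \<alpha> = {}"
    using 1(4) open_circle_arc_subset[of a b] by auto
  ultimately have "open_circle_arc a b \<inter> endpoints \<beta> = {}"
    unfolding ep Int_Un_distrib by simp
  then have "mu_term \<beta> e = 0"
    using e semi_trivial_gen[of _ _ \<beta>] by (auto simp: mu_term_def)
  moreover have "mu_term \<alpha> d = mu_term \<beta> d" if "d \<in> arr \<alpha>" for d
    using that assms by (intro mu_term_eq smove_type1)
  ultimately show ?thesis
    using new by (simp add: mu_string_alt e(1))
qed

lemma mu_string_type2:
  assumes "type2 \<alpha> \<beta>"
  shows "mu_string \<alpha> = mu_string \<beta>"
  using assms
proof cases
  case (1 x y z w a a' b b')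
  have xy: "x \<in> circle_arc x y" "y \<in> circle_arc x y" "z \<in> circle_arc z w" "w \<in> circle_arc z w"
    using 1 circle_arc_ends by auto
  have aa: "{a, a'} \<subseteq> circle_arc x y" "{b, b'} \<subseteq> circle_arc z w"
    unfolding 1(4,5) using xy by auto
  have new: "(a, b) \<notin> arr \<alpha>" "(b', a') \<notin> arr \<alpha>"
    using endpoints_in[of _ _ \<alpha>] aa 1(7) by blast+
  have ne: "(a, b) \<noteq> (b', a')" using aa 1(6) by auto
  have "endpoints \<beta> = {a, a'} \<union> {b, b'} \<union> endpoints \<alpha>"
    using 1(9) by (auto simp: endpoints_def ends_def)
  then have ep: "endpoints \<beta> = {x, y} \<union> {z, w} \<union> endpoints \<alpha>"
    using 1(4,5) by simp
  have "open_circle_arc x y \<inter> {x, y} = {}" "open_circle_arc z w \<inter> {z, w} = {}"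
    using open_circle_arc_ends by auto
  moreover have "open_circle_arc x y \<inter> {z, w} = {}" "open_circle_arc z w \<inter> {x, y} = {}"
    using 1(6) xy open_circle_arc_subset[of x y] open_circle_arc_subset[of z w] by auto
  moreover have "open_circle_arc x y \<inter> endpoints \<alpha> = {}" "open_circle_arc z w \<inter> endpoints \<alpha> = {}"
    using 1(7,8) open_circle_arc_subset[of x y] open_circle_arc_subset[of z w] by auto
  ultimately have oarc: "open_circle_arc x y \<inter> endpoints \<beta> = {}"
    "open_circle_arc z w \<inter> endpoints \<beta> = {}"
    unfolding ep Int_Un_distrib by simp_all
  have "smove (sing \<beta> (a, b) \<epsilon>) (sing \<beta> (b', a') (opp \<epsilon>))" for \<epsilon>
    using 1(4,5,6) oarc by (rule smove_sing2) (simp_all add: 1(9))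
  from smove_class_eq[OF this[of Plus]] smove_class_eq[OF this[of Minus]]
  have "mu_term \<beta> (a, b) + mu_term \<beta> (b', a') = 0"
    by (simp add: mu_term_def)
  moreover have "mu_term \<alpha> d = mu_term \<beta> d" if "d \<in> arr \<alpha>" for d
    using that assms by (intro mu_term_eq smove_type2)
  ultimately show ?thesis
    using new ne by (simp add: mu_string_alt 1(9) flip: add.assoc)
qed

lemma type3_facts:
  assumes "type3 \<alpha> R \<beta>"
  shows "finite R" "inj_on fst R" "inj_on snd R" "fst ` R \<subseteq> arr \<alpha>"
    "arr \<beta> = (arr \<alpha> - fst ` R) \<union> snd ` R" "(arr \<alpha> - fst ` R) \<inter> snd ` R = {}"
proof -
  have *: "finite R \<and> inj_on fst R \<and> inj_on snd R \<and> fst ` R \<subseteq> arr \<alpha> \<and>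
    arr \<beta> = (arr \<alpha> - fst ` R) \<union> snd ` R \<and> (\<forall>f\<in>snd ` R. \<exists>e\<in>fst ` R. ends e \<inter> ends f \<noteq> {})"
    using assms
  proof cases
    case (type3a a p b q c r)
    then have "(p, b) \<in> arr \<alpha>" "(q, c) \<in> arr \<alpha>" "(r, a) \<in> arr \<alpha>" by auto
    then have "{a, b, c, p, q, r} \<subseteq> circle" using arr_circle by blast
    then have "{a, p} \<subseteq> circle_arc a p" "{b, q} \<subseteq> circle_arc b q" "{c, r} \<subseteq> circle_arc c r"
      using circle_arc_ends by auto
    then have "{a, p} \<inter> {b, q} = {}" "{a, p} \<inter> {c, r} = {}" "{b, q} \<inter> {c, r} = {}"
      using type3a(1) unfolding free_arcs_def by (metis Int_mono subset_empty)+
    then have ne: "a \<noteq> b" "a \<noteq> q" "p \<noteq> b" "p \<noteq> q" "a \<noteq> c" "a \<noteq> r" "p \<noteq> c" "p \<noteq> r"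
      "b \<noteq> c" "b \<noteq> r" "q \<noteq> c" "q \<noteq> r" by auto
    have "finite R" "inj_on fst R" "inj_on snd R"
      unfolding type3a(2) using ne ne[symmetric] by (simp_all add: inj_on_def)
    moreover have "\<forall>f\<in>snd ` R. \<exists>e\<in>fst ` R. ends e \<inter> ends f \<noteq> {}"
      unfolding type3a(2) by (simp add: ends_def)
    ultimately show ?thesis using type3a(3,4) by blast
  next
    case (type3b a p b q c r)
    then have "(a, b) \<in> arr \<alpha>" "(p, c) \<in> arr \<alpha>" "(q, r) \<in> arr \<alpha>" by auto
    then have "{a, b, c, p, q, r} \<subseteq> circle" using arr_circle by blast
    then have "{a, p} \<subseteq> circle_arc a p" "{b, q} \<subseteq> circle_arc b q" "{c, r} \<subseteq> circle_arc c r"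
      using circle_arc_ends by auto
    then have "{a, p} \<inter> {b, q} = {}" "{a, p} \<inter> {c, r} = {}" "{b, q} \<inter> {c, r} = {}"
      using type3b(1) unfolding free_arcs_def by (metis Int_mono subset_empty)+
    then have ne: "a \<noteq> b" "a \<noteq> q" "p \<noteq> b" "p \<noteq> q" "a \<noteq> c" "a \<noteq> r" "p \<noteq> c" "p \<noteq> r"
      "b \<noteq> c" "b \<noteq> r" "q \<noteq> c" "q \<noteq> r" by auto
    have "finite R" "inj_on fst R" "inj_on snd R"
      unfolding type3b(2) using ne ne[symmetric] by (simp_all add: inj_on_def)
    moreover have "\<forall>f\<in>snd ` R. \<exists>e\<in>fst ` R. ends e \<inter> ends f \<noteq> {}"
      unfolding type3b(2) by (simp add: ends_def)
    ultimately show ?thesis using type3b(3,4) by blast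
  qed
  then show "finite R" "inj_on fst R" "inj_on snd R" "fst ` R \<subseteq> arr \<alpha>"
    "arr \<beta> = (arr \<alpha> - fst ` R) \<union> snd ` R" by auto
  show "(arr \<alpha> - fst ` R) \<inter> snd ` R = {}"
  proof (rule ccontr)
    assume "(arr \<alpha> - fst ` R) \<inter> snd ` R \<noteq> {}"
    then obtain f where f: "f \<in> arr \<alpha>" "f \<notin> fst ` R" "f \<in> snd ` R" by blast
    have "\<forall>f\<in>snd ` R. \<exists>e\<in>fst ` R. ends e \<inter> ends f \<noteq> {}" "fst ` R \<subseteq> arr \<alpha>"
      using * by simp_all
    then obtain e where e: "e \<in> fst ` R" "ends e \<inter> ends f \<noteq> {}" "e \<in> arr \<alpha>"
      using f(3) by (meson subsetD)
    then obtain v where "v \<in> ends e" "v \<in> ends f" by auto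
    then have "e = f" using arr_disjoint e(3) f(1) by metis
    with e(1) f(2) show False by simp
  qed
qed

lemma mu_string_type3:
  assumes "type3 \<alpha> R \<beta>"
  shows "mu_string \<alpha> = mu_string \<beta>"
proof -
  note R = type3_facts[OF assms]
  have "mu_string \<alpha> = (\<Sum>e\<in>arr \<alpha> - fst ` R. mu_term \<alpha> e) + (\<Sum>e\<in>fst ` R. mu_term \<alpha> e)"
    unfolding mu_string_alt using R(4) by (intro sum.subset_diff) auto
  also have "(\<Sum>e\<in>arr \<alpha> - fst ` R. mu_term \<alpha> e) = (\<Sum>e\<in>arr \<alpha> - fst ` R. mu_term \<beta> e)"
    using assms by (intro sum.cong refl mu_term_eq smove_type3) auto
  also have "(\<Sum>e\<in>fst ` R. mu_term \<alpha> e) = (\<Sum>u\<in>R. mu_term \<alpha> (fst u))"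
    using R(2) by (simp add: sum.reindex)
  also have "\<dots> = (\<Sum>u\<in>R. mu_term \<beta> (snd u))"
    using assms by (intro sum.cong refl mu_term_eq smove_sing3) auto
  also have "\<dots> = (\<Sum>e\<in>snd ` R. mu_term \<beta> e)"
    using R(3) by (simp add: sum.reindex)
  also have "(\<Sum>e\<in>arr \<alpha> - fst ` R. mu_term \<beta> e) + \<dots> = mu_string \<beta>"
    unfolding mu_string_alt R(5) using R(1,6) by (intro sum.union_disjoint[symmetric]) auto
  finally show ?thesis .
qed

lemma mu_string_vmove:
  assumes "vmove \<alpha> \<beta>"
  shows "mu_string \<alpha> = mu_string \<beta>"
  using assms
proof cases
  case (vmove_homeo h)
  then show ?thesis by (rule mu_string_homeo)
next
  case vmove_type1
  then show ?thesis by (rule mu_string_type1)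
next
  case vmove_type2
  then show ?thesis by (rule mu_string_type2)
next
  case (vmove_type3 R)
  then show ?thesis by (rule mu_string_type3)
qed

lemma mu_string_homotopic:
  assumes "homotopic_strings \<alpha> \<beta>"
  shows "mu_string \<alpha> = mu_string \<beta>"
  using assms unfolding homotopic_strings_def
proof (induction rule: equivclp_induct)
  case base
  show ?case ..
next
  case (step \<beta> \<gamma>)
  from step(2) have "mu_string \<beta> = mu_string \<gamma>"
  proof
    assume "vmove \<beta> \<gamma>"
    then show ?thesis by (rule mu_string_vmove)
  next
    assume "vmove \<gamma> \<beta>"
    then show ?thesis by (rule mu_string_vmove[symmetric])
  qed
  with step(3) show ?case by (rule trans)
qed

lemma mu_string_class: "mu (string_class \<alpha>) = mu_string \<alpha>"
proof -
  have "mu_string \<beta> = mu_string \<alpha>" if "\<beta> \<in> string_class \<alpha>" for \<beta>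
    using that mu_string_homotopic[of \<alpha> \<beta>] by (simp add: string_class_def)
  moreover have "\<alpha> \<in> string_class \<alpha>" by (simp add: string_class_def)
  ultimately have "mu_string ` string_class \<alpha> = {mu_string \<alpha>}" by blast
  then show ?thesis by (simp only: mu_def the_elem_eq)
qed

definition num_terms :: "('c \<Rightarrow>\<^sub>0 int) \<Rightarrow> int" where
  "num_terms L = (\<Sum>c\<in>Poly_Mapping.keys L. \<bar>Poly_Mapping.lookup L c\<bar>)"

section \<open>Based matrices\<close>

record ('g, 'h) based_matrix =
  elts :: "'g set"
  base :: 'g
  form :: "'g \<Rightarrow> 'g \<Rightarrow> 'h"

definition is_based_matrix :: "('g, 'h::ab_group_add) based_matrix \<Rightarrow> bool" where
  "is_based_matrix M \<longleftrightarrow> finite (elts M) \<and> base M \<in> elts M \<and>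
     (\<forall>g\<in>elts M. form M g g = 0) \<and>
     (\<forall>g\<in>elts M. \<forall>h\<in>elts M. form M g h = - form M h g)"

definition annihilating :: "('g, 'h::ab_group_add) based_matrix \<Rightarrow> 'g \<Rightarrow> bool" where
  "annihilating M g \<longleftrightarrow> g \<in> elts M - {base M} \<and> (\<forall>h\<in>elts M. form M g h = 0)"

definition core :: "('g, 'h::ab_group_add) based_matrix \<Rightarrow> 'g \<Rightarrow> bool" where
  "core M g \<longleftrightarrow> g \<in> elts M - {base M} \<and> (\<forall>h\<in>elts M. form M g h = form M (base M) h)"

definition complementary :: "('g, 'h::ab_group_add) based_matrix \<Rightarrow> 'g \<Rightarrow> 'g \<Rightarrow> bool" where
  "complementary M g g' \<longleftrightarrow> g \<in> elts M - {base M} \<and> g' \<in> elts M - {base M} \<and> g \<noteq> g' \<and>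
     (\<forall>h\<in>elts M. form M g h + form M g' h = form M (base M) h)"

definition self_complementary :: "('g, 'h::ab_group_add) based_matrix \<Rightarrow> 'g \<Rightarrow> bool" where
  "self_complementary M g \<longleftrightarrow> g \<in> elts M \<and>
     (\<forall>h\<in>elts M. form M g h + form M g h = form M (base M) h)"

definition extends :: "('g, 'h::ab_group_add) based_matrix \<Rightarrow> ('g, 'h) based_matrix \<Rightarrow> 'g set \<Rightarrow> bool" where
  "extends N M X \<longleftrightarrow> is_based_matrix M \<and> is_based_matrix N \<and>
     X \<inter> elts M = {} \<and> elts N = elts M \<union> X \<and> base N = base M \<and>
     (\<forall>g\<in>elts M. \<forall>h\<in>elts M. form N g h = form M g h)"

inductive elem_ext :: "('g, 'h::ab_group_add) based_matrix \<Rightarrow> ('g, 'h) based_matrix \<Rightarrow> bool" where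
  M1: "\<lbrakk>extends N M {g}; annihilating N g\<rbrakk> \<Longrightarrow> elem_ext M N"
| M2: "\<lbrakk>extends N M {g}; core N g\<rbrakk> \<Longrightarrow> elem_ext M N"
| M3: "\<lbrakk>extends N M {g, g'}; complementary N g g'\<rbrakk> \<Longrightarrow> elem_ext M N"

text \<open>Every move enlarges the underlying set, so a nonempty sequence of moves always starts from
  another matrix, and its element set is a subset of the final one; no other element type need be
  considered.\<close>

definition primitive :: "('g, 'h::ab_group_add) based_matrix \<Rightarrow> bool" where
  "primitive M \<longleftrightarrow> is_based_matrix M \<and> \<not> (\<exists>M'. elem_ext\<^sup>+\<^sup>+ M' M)"

section \<open>The based matrix of a virtual string\<close>

text \<open>Open arcs are used so that an arrow does not link itself; for distinct arrows the
  endpoints are distinct and it makes no difference.\<close>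

fun links_pos :: "arrow \<Rightarrow> arrow \<Rightarrow> bool" where
  "links_pos (a, b) (c, d) \<longleftrightarrow> c \<in> open_circle_arc a b \<and> d \<in> open_circle_arc b a"

fun links_neg :: "arrow \<Rightarrow> arrow \<Rightarrow> bool" where
  "links_neg (a, b) (c, d) \<longleftrightarrow> c \<in> open_circle_arc b a \<and> d \<in> open_circle_arc a b"

definition link_index :: "vstring \<Rightarrow> arrow \<Rightarrow> int" where
  "link_index \<alpha> e = int (card {f\<in>arr \<alpha>. links_pos e f}) - int (card {f\<in>arr \<alpha>. links_neg e f})"

fun arc_dot :: "vstring \<Rightarrow> arrow \<Rightarrow> arrow \<Rightarrow> int" where
  "arc_dot \<alpha> (a, b) (c, d) =
     int (card {(x, y) \<in> arr \<alpha>. x \<in> open_circle_arc a b \<and> y \<in> open_circle_arc c d})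
     - int (card {(x, y) \<in> arr \<alpha>. x \<in> open_circle_arc c d \<and> y \<in> open_circle_arc a b})"

definition link_sign :: "arrow \<Rightarrow> arrow \<Rightarrow> int" where
  "link_sign e f = (if links_pos e f then 1 else if links_neg e f then -1 else 0)"

text \<open>\<open>None\<close> is the element s.\<close>

fun T_form :: "vstring \<Rightarrow> arrow option \<Rightarrow> arrow option \<Rightarrow> int" where
  "T_form \<alpha> None None = 0"
| "T_form \<alpha> (Some e) None = link_index \<alpha> e"
| "T_form \<alpha> None (Some e) = - link_index \<alpha> e"
| "T_form \<alpha> (Some e) (Some f) = arc_dot \<alpha> e f + link_sign e f"

definition T_matrix :: "vstring \<Rightarrow> (arrow option, int) based_matrix" where
  "T_matrix \<alpha> = \<lparr>elts = insert None (Some ` arr \<alpha>), base = None, form = T_form \<alpha>\<rparr>"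

lemma Arg2pi_divide_cases:
  assumes "x \<noteq> 0" "z \<noteq> 0"
  shows "Arg2pi (z / x) = (if Arg2pi x \<le> Arg2pi z then Arg2pi z - Arg2pi x
                           else Arg2pi z - Arg2pi x + 2 * pi)"
proof (cases "Arg2pi x \<le> Arg2pi z")
  case True
  with assms show ?thesis by (simp add: Arg2pi_divide)
next
  case False
  then have "Arg2pi (x / z) = Arg2pi x - Arg2pi z"
    using assms by (intro Arg2pi_divide) auto
  moreover have "Arg2pi (z / x) = (if x / z \<in> \<real> then Arg2pi (x / z) else 2 * pi - Arg2pi (x / z))"
    using Arg2pi_inverse[of "x / z"] by simp
  moreover have "Arg2pi (x / z) = pi" if "x / z \<in> \<real>"
    using that False calculation(1) Arg2pi_eq_0_pi[of "x / z"] by auto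
  ultimately show ?thesis using False by auto
qed

lemma links_pos_skew:
  assumes "{a, b, c, d} \<subseteq> circle"
  shows "links_pos (a, b) (c, d) \<longleftrightarrow> links_neg (c, d) (a, b)"
proof -
  have "a \<noteq> 0" "b \<noteq> 0" "c \<noteq> 0" "d \<noteq> 0" using assms by auto
  moreover have "Arg2pi x < 2 * pi" "0 \<le> Arg2pi x" for x
    by (simp_all add: Arg2pi_lt_2pi Arg2pi_ge_0)
  note this[of a] this[of b] this[of c] this[of d]
  ultimately show ?thesis
    using assms by (auto simp: open_circle_arc_def Arg2pi_divide_cases split: if_splits)
qed

lemma T_matrix_based: "is_based_matrix (T_matrix \<alpha>)"
proof -
  have self: "\<not> links_pos e e" "\<not> links_neg e e" for e
    using open_circle_arc_ends by (cases e; simp)+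
  have dot: "arc_dot \<alpha> e f = - arc_dot \<alpha> f e" for e f
    by (cases e; cases f) simp
  have excl: "\<not> (links_pos e f \<and> links_neg e f)" if "e \<in> arr \<alpha>" "f \<in> arr \<alpha>" for e f
  proof -
    obtain a b c d where [simp]: "e = (a, b)" "f = (c, d)" by fastforce
    have "a \<in> circle" "b \<in> circle" using that arr_circle by auto
    then have "a \<noteq> 0" "b \<noteq> 0" by auto
    moreover have "Arg2pi x < 2 * pi" "0 \<le> Arg2pi x" for x
      by (simp_all add: Arg2pi_lt_2pi Arg2pi_ge_0)
    note this[of a] this[of b] this[of c]
    moreover have "c \<in> circle" using that arr_circle by auto
    then have "c \<noteq> 0" by auto
    ultimately show ?thesis
      by (auto simp: open_circle_arc_def Arg2pi_divide_cases split: if_splits)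
  qed
  have sgn: "link_sign e f = - link_sign f e" if "e \<in> arr \<alpha>" "f \<in> arr \<alpha>" for e f
  proof -
    obtain a b c d where ef [simp]: "e = (a, b)" "f = (c, d)" by fastforce
    have "{a, b, c, d} \<subseteq> circle" "{c, d, a, b} \<subseteq> circle" using that arr_circle by auto
    then have "links_pos e f \<longleftrightarrow> links_neg f e" "links_pos f e \<longleftrightarrow> links_neg e f"
      using links_pos_skew unfolding ef by blast+
    then show ?thesis using excl[OF that] by (simp add: link_sign_def del: links_pos.simps links_neg.simps)
  qed
  have skew: "T_form \<alpha> g h = - T_form \<alpha> h g"
    if "g \<in> insert None (Some ` arr \<alpha>)" "h \<in> insert None (Some ` arr \<alpha>)" for g h
  proof (cases g; cases h)
    fix e f assume [simp]: "g = Some e" "h = Some f"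
    with that have "link_sign e f = - link_sign f e" by (intro sgn) auto
    with dot[of e f] show ?thesis by simp
  qed simp_all
  have "T_form \<alpha> g g = 0" for g
  proof (cases g)
    case (Some e)
    with self[of e] dot[of e e] show ?thesis by (simp add: link_sign_def)
  qed simp
  with skew show ?thesis
    unfolding is_based_matrix_def T_matrix_def based_matrix.simps
    by (intro conjI ballI) (assumption | simp del: T_form.simps; fail | blast)+
qed

end

theory Submission
  imports Defs
begin

text \<open>
  The proof replaces a signed singular string \<open>\<alpha>\<^sub>d\<^sup>\<epsilon>\<close> by a computable invariant: the based matrix
  \<open>T(\<alpha>)\<close> together with one marked row, namely the row of \<open>d\<close> if \<open>\<epsilon>\<close> is \<open>+\<close>, and the row of \<open>s\<close>
  minus the row of \<open>d\<close> if \<open>\<epsilon>\<close> is \<open>-\<close> (\<open>mark_row\<close>). Two parallel arrows, as in a move of type 2,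
  are complementary, so passing from one to the other and reversing the sign leaves the
  marked row as it is. A move of type 3 or a homeomorphism is an isomorphism of marked matrices, and
  a move of type 1 or 2 adds an annihilating or core element or a complementary pair. Deleting such
  elements, as long as the marking survives, is a terminating rewriting process that is confluent
  up to isomorphism (\<open>reduction_confluent\<close>). Hence the property of reducing to a given
  irreducible marked matrix is invariant under homotopy (\<open>sstring_reduces_homotopic\<close>).

  Let \<open>T(\<alpha>)\<close> be primitive, with \<open>n\<close> arrows. The distinguished arrow of a semi-trivial string has the
  row 0 or the row of \<open>s\<close>. If the class of some \<open>\<alpha>\<^sub>e\<^sup>\<epsilon>\<close> contained such a string, then \<open>e\<close> would be
  annihilating or core in \<open>T(\<alpha>)\<close>; so no term of \<open>\<mu>\<close> vanishes. If \<open>\<alpha>\<^sub>e\<^sup>+\<close> and \<open>\<alpha>\<^sub>f\<^sup>-\<close> are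
  homotopic, then an automorphism of \<open>T(\<alpha>)\<close> carries the row of \<open>s\<close> minus the row of \<open>f\<close> to the row of
  \<open>e\<close>, that is, it carries \<open>f\<close> to an element complementary to \<open>e\<close>. In a primitive matrix this leaves
  only the case that \<open>e = f\<close> is self-complementary, and at most one arrow is so. Therefore at most
  the two terms of a single arrow cancel, and \<open>t(\<mu>)\<close> is \<open>2n\<close> or, if that arrow exists, possibly
  \<open>2n - 2\<close>. Conversely \<open>\<mu>\<close> is a homotopy invariant to which each arrow contributes at most two
  terms, so every string homotopic to \<open>\<alpha>\<close> has at least \<open>t(\<mu>)/2\<close> arrows. The theorem follows since
  \<open>\<alpha>\<close> itself has \<open>n\<close>.

  The effect of the moves on \<open>T(\<alpha>)\<close> is read off from a uniform formula for the form
  (\<open>T_form_pairing\<close>): it is the value on \<open>w\<^sub>g\<close> and \<open>w\<^sub>h\<close> of the skew bilinear pairing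
  \<open>\<Sum> \<phi>(x) \<psi>(y) - \<psi>(x) \<phi>(y)\<close> over the arrows \<open>(x, y)\<close> of \<open>\<alpha>\<close>. Here \<open>w\<^sub>s = 1\<close>, and \<open>w\<^sub>e\<close> is 1 on
  the open arc from the tail to the head of \<open>e\<close>, 1/2 at these two points and 0 elsewhere. The
  weights 1/2 account for the linking term \<open>\<sigma>\<close>.
\<close>

section \<open>Reduction of marked based matrices\<close>

type_synonym 'g bmatrix = "('g, int) based_matrix"

definition delete :: "'g bmatrix \<Rightarrow> 'g set \<Rightarrow> 'g bmatrix" where
  "delete M Z = M\<lparr>elts := elts M - Z\<rparr>"

lemma delete_simps [simp]:
  "elts (delete M Z) = elts M - Z" "base (delete M Z) = base M" "form (delete M Z) = form M"
  "delete (delete M Y) Z = delete M (Y \<union> Z)"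
proof -
  have "elts M - Y - Z = elts M - (Y \<union> Z)" by blast
  then show "delete (delete M Y) Z = delete M (Y \<union> Z)" by (simp add: delete_def)
qed (simp_all add: delete_def)

definition removable :: "'g bmatrix \<Rightarrow> 'g set \<Rightarrow> bool" where
  "removable M Z \<longleftrightarrow> (\<exists>g. Z = {g} \<and> (annihilating M g \<or> core M g)) \<or>
     (\<exists>g h. Z = {g, h} \<and> complementary M g h)"

text \<open>The element \<open>x\<close> may be the base element, which gives the functions 0 and row of \<open>s\<close>. These are
  what remains of a marked annihilating or core element after its deletion.\<close>

definition marking :: "'g bmatrix \<Rightarrow> ('g \<Rightarrow> int) \<Rightarrow> bool" where
  "marking M \<rho> \<longleftrightarrow> (\<exists>x\<in>elts M. (\<forall>h\<in>elts M. \<rho> h = form M x h) \<or>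
     (\<forall>h\<in>elts M. \<rho> h = form M (base M) h - form M x h))"

definition marked_iso :: "('g \<Rightarrow> 'k) \<Rightarrow> 'g bmatrix \<Rightarrow> ('g \<Rightarrow> int) \<Rightarrow> 'k bmatrix \<Rightarrow> ('k \<Rightarrow> int) \<Rightarrow> bool" where
  "marked_iso \<phi> M \<rho> N \<sigma> \<longleftrightarrow> bij_betw \<phi> (elts M) (elts N) \<and> \<phi> (base M) = base N \<and>
     (\<forall>g\<in>elts M. \<forall>h\<in>elts M. form N (\<phi> g) (\<phi> h) = form M g h) \<and>
     (\<forall>h\<in>elts M. \<sigma> (\<phi> h) = \<rho> h)"

text \<open>The function \<open>\<rho>\<close> has to be a marking of every matrix on the way. So a complementary pair that
  contains the marked element can be deleted only if some other element represents the same row.\<close>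

inductive reduces :: "'k bmatrix \<Rightarrow> ('k \<Rightarrow> int) \<Rightarrow> 'g bmatrix \<Rightarrow> ('g \<Rightarrow> int) \<Rightarrow> bool"
  for P \<sigma> where
  iso: "\<lbrakk>is_based_matrix M; marking M \<rho>; marked_iso \<phi> M \<rho> P \<sigma>\<rbrakk> \<Longrightarrow> reduces P \<sigma> M \<rho>"
| step: "\<lbrakk>is_based_matrix M; marking M \<rho>; removable M Z; reduces P \<sigma> (delete M Z) \<rho>\<rbrakk>
    \<Longrightarrow> reduces P \<sigma> M \<rho>"

lemma reduces_marking: "reduces P \<sigma> M \<rho> \<Longrightarrow> is_based_matrix M \<and> marking M \<rho>"
  by (erule reduces.cases) auto

lemma removable_subset: "removable M Z \<Longrightarrow> Z \<subseteq> elts M - {base M} \<and> Z \<noteq> {}"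
  by (auto simp: removable_def annihilating_def core_def complementary_def)

lemma based_delete: "is_based_matrix M \<Longrightarrow> base M \<notin> Z \<Longrightarrow> is_based_matrix (delete M Z)"
  unfolding is_based_matrix_def delete_simps by blast

lemma marked_iso_trans:
  "marked_iso \<phi> M \<rho> N \<sigma> \<Longrightarrow> marked_iso \<psi> N \<sigma> P \<tau> \<Longrightarrow> marked_iso (\<psi> \<circ> \<phi>) M \<rho> P \<tau>"
  unfolding marked_iso_def by (auto intro: bij_betw_trans dest: bij_betwE)

lemma marked_iso_sym:
  assumes "marked_iso \<phi> M \<rho> N \<sigma>" "base M \<in> elts M"
  shows "marked_iso (inv_into (elts M) \<phi>) N \<sigma> M \<rho>"
proof -
  have bij: "bij_betw \<phi> (elts M) (elts N)" using assms by (simp add: marked_iso_def)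
  note inv = bij_betw_inv_into[OF bij]
  have l: "inv_into (elts M) \<phi> (\<phi> x) = x" if "x \<in> elts M" for x
    using bij that by (simp add: bij_betw_inv_into_left)
  have r: "\<phi> (inv_into (elts M) \<phi> y) = y" "inv_into (elts M) \<phi> y \<in> elts M" if "y \<in> elts N" for y
    using bij that bij_betwE[OF inv] by (auto simp: bij_betw_inv_into_right)
  have "inv_into (elts M) \<phi> (base N) = base M"
    using l[OF assms(2)] assms(1) by (simp add: marked_iso_def)
  with inv r show ?thesis
    using assms(1) unfolding marked_iso_def by metis
qed

lemma marked_iso_marking:
  assumes "marked_iso \<phi> M \<rho> N \<sigma>" "base M \<in> elts M" "marking M \<rho>"
  shows "marking N \<sigma>"
proof -
  have surj: "elts N = \<phi> ` elts M" using assms by (auto simp: marked_iso_def bij_betw_def)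
  have f: "form N (\<phi> g) (\<phi> h) = form M g h" if "g \<in> elts M" "h \<in> elts M" for g h
    using assms that by (simp add: marked_iso_def)
  have r: "\<sigma> (\<phi> h) = \<rho> h" if "h \<in> elts M" for h
    using assms that by (simp add: marked_iso_def)
  have b: "base N = \<phi> (base M)" using assms by (simp add: marked_iso_def)
  show ?thesis
    using assms(2,3) unfolding marking_def surj b by (auto simp: f r)
qed

lemma marked_iso_removable:
  assumes "marked_iso \<phi> M \<rho> N \<sigma>" "base M \<in> elts M" "removable M Z"
  shows "removable N (\<phi> ` Z)" "marked_iso \<phi> (delete M Z) \<rho> (delete N (\<phi> ` Z)) \<sigma>"
proof -
  have surj: "elts N = \<phi> ` elts M" and inj: "inj_on \<phi> (elts M)"
    using assms by (auto simp: marked_iso_def bij_betw_def)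
  have b: "base N = \<phi> (base M)" using assms by (simp add: marked_iso_def)
  have ne: "\<phi> x \<noteq> \<phi> y" if "x \<in> elts M" "y \<in> elts M" "x \<noteq> y" for x y
    using inj that by (auto dest: inj_onD)
  have f: "form N (\<phi> g) (\<phi> h) = form M g h" if "g \<in> elts M" "h \<in> elts M" for g h
    using assms that by (simp add: marked_iso_def)
  consider (1) g where "Z = {g}" "annihilating M g" | (2) g where "Z = {g}" "core M g"
    | (3) g h where "Z = {g, h}" "complementary M g h"
    using assms(3) by (auto simp: removable_def)
  then show "removable N (\<phi> ` Z)"
  proof cases
    case 1
    then have "annihilating N (\<phi> g)"
      using ne assms(2) by (auto simp: annihilating_def surj b f)
    with 1 show ?thesis by (auto simp: removable_def)
  next
    case 2
    then have "core N (\<phi> g)"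
      using ne assms(2) by (auto simp: core_def surj b f)
    with 2 show ?thesis by (auto simp: removable_def)
  next
    case 3
    then have "complementary N (\<phi> g) (\<phi> h)"
      using ne assms(2) by (auto simp: complementary_def surj b f)
    with 3 show ?thesis unfolding removable_def by auto
  qed
  have Z: "Z \<subseteq> elts M" using removable_subset[OF assms(3)] by auto
  have "\<phi> ` (elts M - Z) = \<phi> ` elts M - \<phi> ` Z"
    using inj Z by (simp add: inj_on_image_set_diff[OF _ _ Z])
  then show "marked_iso \<phi> (delete M Z) \<rho> (delete N (\<phi> ` Z)) \<sigma>"
    using assms(1) inj unfolding marked_iso_def
    by (auto simp: bij_betw_def inj_on_def)
qed

lemma reduces_iso:
  assumes "reduces P \<sigma> M \<rho>" "marked_iso \<phi> M \<rho> N \<tau>" "is_based_matrix N"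
  shows "reduces P \<sigma> N \<tau>"
  using assms
proof (induction arbitrary: \<phi> N \<tau>)
  case (iso M \<rho> \<psi>)
  then have "base M \<in> elts M" by (simp add: is_based_matrix_def)
  then have "marking N \<tau>" "marked_iso (inv_into (elts M) \<phi>) N \<tau> M \<rho>"
    using iso marked_iso_marking marked_iso_sym by blast+
  then show ?case
    using marked_iso_trans iso reduces.iso by blast
next
  case (step M \<rho> Z)
  then have b: "base M \<in> elts M" by (simp add: is_based_matrix_def)
  note rem = marked_iso_removable[OF step.prems(1) b step.hyps(3)]
  have "marking N \<tau>" using marked_iso_marking[OF step.prems(1) b step.hyps(2)] .
  moreover have "is_based_matrix (delete N (\<phi> ` Z))"
    using removable_subset[OF rem(1)] step.prems(2) by (auto intro: based_delete)
  ultimately show ?case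
    using reduces.step[OF step.prems(2) _ rem(1)] step.IH[OF rem(2)] by blast
qed

lemma removable_delete:
  assumes "removable M Z" "Y \<inter> Z = {}" "base M \<notin> Y"
  shows "removable (delete M Y) Z"
proof -
  have "annihilating (delete M Y) g" if "annihilating M g" "g \<notin> Y" for g
    using that by (simp add: annihilating_def)
  moreover have "core (delete M Y) g" if "core M g" "g \<notin> Y" for g
    using that by (simp add: core_def)
  moreover have "complementary (delete M Y) g h" if "complementary M g h" "g \<notin> Y" "h \<notin> Y" for g h
    using that by (simp add: complementary_def)
  ultimately show ?thesis
    using assms(1,2) unfolding removable_def by blast
qed

text \<open>Elements with equal rows also have equal columns, by skew symmetry. A marking is a combination of
  rows, hence takes equal values on them.\<close>

lemma swap_twins_iso:
  assumes M: "is_based_matrix M" "marking M \<rho>"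
    and gh: "g \<in> elts M" "h \<in> elts M" "g \<noteq> base M" "h \<noteq> base M"
    and twin: "\<And>x. x \<in> elts M \<Longrightarrow> form M g x = form M h x"
    and phi: "\<phi> = Transposition.transpose g h"
  shows "marked_iso \<phi> M \<rho> M \<rho>"
proof -
  have skew: "form M x y = - form M y x" if "x \<in> elts M" "y \<in> elts M" for x y
    using M that unfolding is_based_matrix_def by blast
  have sym: "form M x g = form M x h" if "x \<in> elts M" for x
    by (metis skew that twin gh(1,2))
  have f: "form M (\<phi> x) y = form M x y" if "x \<in> elts M" "y \<in> elts M" for x y
    using that twin gh by (auto simp: phi Transposition.transpose_def)
  have f': "form M x (\<phi> y) = form M x y" if "x \<in> elts M" "y \<in> elts M" for x y
    using that sym gh by (auto simp: phi Transposition.transpose_def)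
  have mem: "\<phi> x \<in> elts M" if "x \<in> elts M" for x
    using that gh by (auto simp: phi Transposition.transpose_def)
  have "base M \<in> elts M" using M by (simp add: is_based_matrix_def)
  then have "\<rho> (\<phi> x) = \<rho> x" if "x \<in> elts M" for x
    using M(2) that f' mem[OF that] unfolding marking_def by auto
  moreover have "bij_betw \<phi> (elts M) (elts M)"
    using mem by (intro bij_betw_byWitness[where f' = \<phi>]) (auto simp: phi)
  moreover have "\<phi> (base M) = base M" using gh by (simp add: phi)
  ultimately show ?thesis using f f' mem by (simp add: marked_iso_def)
qed

text \<open>A deletion destroys a marking only if it removes the element that represents it. If that element
  is annihilating or core, the base element represents the marking instead. So it lies in a
  complementary pair, and as one of the two rows is the row of \<open>s\<close> minus the other, the marking may
  be taken to be the row itself.\<close>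

lemma marking_of_removable:
  assumes M: "is_based_matrix M" "marking M \<rho>" and Z: "removable M Z"
    and no: "\<not> marking (delete M Z) \<rho>"
  obtains g h where "Z = {g, h}" "complementary M g h" "\<forall>x\<in>elts M. \<rho> x = form M g x"
proof -
  have b: "base M \<in> elts M" "base M \<notin> Z"
    using M removable_subset[OF Z] by (auto simp: is_based_matrix_def)
  obtain x where x: "x \<in> elts M" "(\<forall>h\<in>elts M. \<rho> h = form M x h) \<or>
     (\<forall>h\<in>elts M. \<rho> h = form M (base M) h - form M x h)"
    using M(2) by (auto simp: marking_def)
  have xZ: "x \<in> Z"
  proof (rule ccontr)
    assume "x \<notin> Z"
    then have "x \<in> elts (delete M Z)" using x(1) by simp
    then have "marking (delete M Z) \<rho>" using x(2) unfolding marking_def by (intro bexI[of _ x]) auto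
    with no show False ..
  qed
  have bad: False if "(\<forall>h\<in>elts M. \<rho> h = 0) \<or> (\<forall>h\<in>elts M. \<rho> h = form M (base M) h)"
  proof -
    have "marking (delete M Z) \<rho>"
      unfolding marking_def using that b by (intro bexI[of _ "base M"]) auto
    with no show False ..
  qed
  have comm: "complementary M y x" if "complementary M x y" for x y
    using that by (auto simp: complementary_def add.commute)
  consider (1) "Z = {x}" "annihilating M x \<or> core M x"
    | (3) y where "Z = {x, y}" "complementary M x y"
    using Z xZ comm unfolding removable_def by blast
  then show ?thesis
  proof cases
    case 1
    then show ?thesis using bad x(2) by (auto simp: annihilating_def core_def)
  next
    case (3 y)
    then have y: "form M (base M) h - form M x h = form M y h" if "h \<in> elts M" for h
      using that unfolding complementary_def by (metis add_diff_cancel_left')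
    have "complementary M y x" "Z = {y, x}"
      using 3 comm by auto
    with 3 x(2) y show ?thesis using that by metis
  qed
qed

lemma complementary_sym: "complementary M g h \<Longrightarrow> complementary M h g"
  by (auto simp: complementary_def add.commute)

text \<open>Both pairs represent the same marking, so the rows of \<open>g\<close> and \<open>h\<close> agree on the common rest \<open>?H\<close>,
  and then so do those of \<open>g'\<close> and \<open>h'\<close>. Within a pair no choice is left: the value on
  \<open>(g, g')\<close> is the value on \<open>(g, s)\<close>, because \<open>g\<close> and \<open>g'\<close> are complementary. Therefore replacing
  \<open>h, h'\<close> by \<open>g, g'\<close> is an isomorphism.\<close>

lemma twin_pairs_iso:
  assumes M: "is_based_matrix M" and disj: "{g, g'} \<inter> {h, h'} = {}"
    and g: "complementary (delete M {h, h'}) g g'" "\<And>x. x \<in> elts M - {h, h'} \<Longrightarrow> \<rho> x = form M g x"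
    and h: "complementary (delete M {g, g'}) h h'" "\<And>x. x \<in> elts M - {g, g'} \<Longrightarrow> \<rho> x = form M h x"
  shows "\<exists>\<phi>. marked_iso \<phi> (delete M {g, g'}) \<rho> (delete M {h, h'}) \<rho>"
proof -
  let ?s = "base M" and ?H = "elts M - {g, g', h, h'}"
  define \<phi> where "\<phi> x = (if x = h then g else if x = h' then g' else x)" for x
  have skew: "form M x y = - form M y x" if "x \<in> elts M" "y \<in> elts M" for x y
    using M that unfolding is_based_matrix_def by blast
  have self: "form M x x = 0" if "x \<in> elts M" for x
    using M that unfolding is_based_matrix_def by blast
  have g': "form M g x + form M g' x = form M ?s x" if "x \<in> elts M - {h, h'}" for x
    using g(1) that by (simp add: complementary_def)
  have h': "form M h x + form M h' x = form M ?s x" if "x \<in> elts M - {g, g'}" for x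
    using h(1) that by (simp add: complementary_def)
  have mem: "g \<in> elts M" "g' \<in> elts M" "h \<in> elts M" "h' \<in> elts M" "g \<noteq> g'" "h \<noteq> h'"
    "g \<noteq> ?s" "g' \<noteq> ?s" "h \<noteq> ?s" "h' \<noteq> ?s"
    using g(1) h(1) by (auto simp: complementary_def)
  have ne: "g \<noteq> h" "g \<noteq> h'" "g' \<noteq> h" "g' \<noteq> h'" using disj by auto
  have s: "?s \<in> ?H" using M mem by (auto simp: is_based_matrix_def)
  have gh: "form M g x = form M h x" if "x \<in> ?H" for x
    using g(2)[of x] h(2)[of x] that by simp
  have gh': "form M g' x = form M h' x" if "x \<in> ?H" for x
    using g'[of x] h'[of x] gh[OF that] that by simp
  have xg: "form M x g = form M x h" "form M x g' = form M x h'" if "x \<in> ?H" for x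
    using gh[OF that] gh'[OF that] skew that mem by (metis DiffD1)+
  have gg: "form M g g' = form M g ?s"
    using g'[of g] self[of g] skew[of g g'] skew[of g ?s] mem ne s by auto
  have hh: "form M h h' = form M h ?s"
    using h'[of h] self[of h] skew[of h h'] skew[of h ?s] mem ne s by auto
  have ghs: "form M g g' = form M h h'" using gg hh gh[OF s] by simp
  then have ghs': "form M g' g = form M h' h" using skew mem by metis
  have mem\<phi>: "x = h \<or> x = h' \<or> x \<in> ?H" if "x \<in> elts M - {g, g'}" for x
    using that by auto
  have \<phi>: "\<phi> h = g" "\<phi> h' = g'" "\<phi> x = x" if "x \<in> ?H" for x
    using that mem by (auto simp: \<phi>_def)
  have form: "form M (\<phi> x) (\<phi> y) = form M x y" if "x \<in> elts M - {g, g'}" "y \<in> elts M - {g, g'}" for x y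
    using mem\<phi>[OF that(1)] mem\<phi>[OF that(2)] \<phi> s gh gh' xg ghs ghs' self mem by metis
  have "\<rho> g = 0" "\<rho> h = 0" "\<rho> g' = form M g ?s" "\<rho> h' = form M h ?s"
    using g(2)[of g] h(2)[of h] g(2)[of g'] h(2)[of h'] self mem ne gg hh by auto
  then have mark: "\<rho> (\<phi> x) = \<rho> x" if "x \<in> elts M - {g, g'}" for x
    using mem\<phi>[OF that] \<phi> s gh[OF s] by metis
  have "bij_betw \<phi> (elts M - {g, g'}) (elts M - {h, h'})"
    using mem ne
    by (intro bij_betw_byWitness[where f' = "\<lambda>x. if x = g then h else if x = g' then h' else x"])
      (auto simp: \<phi>_def)
  then have "marked_iso \<phi> (delete M {g, g'}) \<rho> (delete M {h, h'}) \<rho>"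
    unfolding marked_iso_def using form mark \<phi>(3)[OF s] by simp
  then show ?thesis by blast
qed

text \<open>Disjoint deletions commute unless the marking is lost when both are made; then the marking is
  represented by each of two complementary pairs, and deleting either gives isomorphic results.
  If the deletions overlap in \<open>x\<close>, either \<open>x\<close> is annihilating or core and its partner in the other
  deletion is core or annihilating, or both deletions are pairs and the two partners of \<open>x\<close> have
  the same row.\<close>

lemma reduction_confluent:
  assumes M: "is_based_matrix M" "marking M \<rho>"
    and Y: "removable M Y" "marking (delete M Y) \<rho>"
    and Z: "removable M Z" "marking (delete M Z) \<rho>"
  shows "(\<exists>\<phi>. marked_iso \<phi> (delete M Y) \<rho> (delete M Z) \<rho>) \<or>
     (marking (delete M (Y \<union> Z)) \<rho> \<and> (Z \<subseteq> Y \<or> removable (delete M Y) (Z - Y)) \<and>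
       (Y \<subseteq> Z \<or> removable (delete M Z) (Y - Z)))"
proof (cases "Y \<inter> Z = {}")
  case True
  have b: "base M \<notin> Y" "base M \<notin> Z" using removable_subset Y Z by blast+
  have d: "Z - Y = Z" "Y - Z = Y" using True by auto
  have MY: "is_based_matrix (delete M Y)" "is_based_matrix (delete M Z)"
    using M b based_delete by blast+
  have r: "removable (delete M Y) Z" "removable (delete M Z) Y"
    using Y Z True b removable_delete by blast+
  show ?thesis
  proof (cases "marking (delete M (Y \<union> Z)) \<rho>")
    case True
    with r d show ?thesis by simp
  next
    case no: False
    have noY: "\<not> marking (delete (delete M Y) Z) \<rho>" and noZ: "\<not> marking (delete (delete M Z) Y) \<rho>"
      using no by (simp_all add: Un_commute)
    obtain h h' where hh: "Z = {h, h'}" "complementary (delete M Y) h h'"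
        "\<forall>x\<in>elts (delete M Y). \<rho> x = form (delete M Y) h x"
      by (rule marking_of_removable[OF MY(1) Y(2) r(1) noY])
    obtain g g' where gg: "Y = {g, g'}" "complementary (delete M Z) g g'"
        "\<forall>x\<in>elts (delete M Z). \<rho> x = form (delete M Z) g x"
      by (rule marking_of_removable[OF MY(2) Z(2) r(2) noZ])
    have "\<exists>\<phi>. marked_iso \<phi> (delete M {g, g'}) \<rho> (delete M {h, h'}) \<rho>"
      using True hh gg by (intro twin_pairs_iso M) auto
    then show ?thesis using hh gg by simp
  qed
next
  case False
  have single: "removable (delete M {x}) {y}" if "annihilating M x \<or> core M x" "complementary M x y" for x y
  proof -
    have "y \<in> elts (delete M {x}) - {base M}" using that by (auto simp: complementary_def)
    moreover have "form M x h + form M y h = form M (base M) h" if "h \<in> elts M" for h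
      using \<open>complementary M x y\<close> that by (simp add: complementary_def)
    ultimately have "annihilating (delete M {x}) y \<or> core (delete M {x}) y"
      using that(1) by (auto simp: annihilating_def core_def)
    then show ?thesis by (auto simp: removable_def)
  qed
  have shape: "(\<exists>g. W = {g} \<and> g = x \<and> (annihilating M g \<or> core M g)) \<or>
      (\<exists>h. W = {x, h} \<and> complementary M x h)"
    if "removable M W" "x \<in> W" for W x
  proof -
    consider (1) g where "W = {g}" "annihilating M g \<or> core M g" | (2) g h where "W = {g, h}" "complementary M g h"
      using \<open>removable M W\<close> unfolding removable_def by blast
    then show ?thesis
    proof cases
      case 1
      with \<open>x \<in> W\<close> show ?thesis by auto
    next
      case (2 g h)
      with \<open>x \<in> W\<close> consider "x = g" | "x = h" by auto
      then show ?thesis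
      proof cases
        case 1
        with 2 show ?thesis by blast
      next
        case b: 2
        with 2 have "W = {x, g}" "complementary M x g" using complementary_sym by auto
        then show ?thesis by blast
      qed
    qed
  qed
  obtain x where x: "x \<in> Y" "x \<in> Z" using False by blast
  consider (1) "Y = Z" | (2) y where "Y = {x}" "annihilating M x \<or> core M x" "Z = {x, y}" "complementary M x y"
    | (3) y where "Z = {x}" "annihilating M x \<or> core M x" "Y = {x, y}" "complementary M x y"
    | (4) y z where "Y = {x, y}" "Z = {x, z}" "complementary M x y" "complementary M x z" "y \<noteq> z"
    using shape[OF Y(1) x(1)] shape[OF Z(1) x(2)] by metis
  then show ?thesis
  proof cases
    case 1
    then show ?thesis using Y by simp
  next
    case (2 y)
    then have "Z - Y = {y}" "Y \<union> Z = Z" "Y \<subseteq> Z" by (auto simp: complementary_def)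
    then show ?thesis using single[OF 2(2,4)] 2 Z by simp
  next
    case (3 y)
    then have "Y - Z = {y}" "Y \<union> Z = Y" "Z \<subseteq> Y" by (auto simp: complementary_def)
    then show ?thesis using single[OF 3(2,4)] 3 Y by simp
  next
    case (4 y z)
    let ?\<phi> = "Transposition.transpose y z"
    have yz: "y \<in> elts M" "z \<in> elts M" "y \<noteq> base M" "z \<noteq> base M" "x \<noteq> y" "x \<noteq> z"
      using 4(3,4) by (auto simp: complementary_def)
    have twin: "form M y h = form M z h" if "h \<in> elts M" for h
      using 4(3,4) that unfolding complementary_def by (metis add_left_cancel)
    have "marked_iso ?\<phi> M \<rho> M \<rho>"
      using swap_twins_iso[OF M yz(1-4) twin refl] .
    from marked_iso_removable(2)[OF this _ Y(1)] M
    have "marked_iso ?\<phi> (delete M Y) \<rho> (delete M (?\<phi> ` Y)) \<rho>"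
      by (simp add: is_based_matrix_def)
    moreover have "?\<phi> ` Y = Z" using 4 yz by simp
    ultimately show ?thesis by auto
  qed
qed

definition irreducible_matrix :: "'g bmatrix \<Rightarrow> bool" where
  "irreducible_matrix P \<longleftrightarrow> (\<forall>Z. \<not> removable P Z)"

text \<open>Newman's argument: a first step of the given reduction is compared with the deletion of \<open>Z\<close> by
  local confluence, and the induction hypothesis applies to the smaller matrix.\<close>

lemma reduces_delete:
  assumes "irreducible_matrix P" "reduces P \<sigma> M \<rho>" "removable M Z" "marking (delete M Z) \<rho>"
  shows "reduces P \<sigma> (delete M Z) \<rho>"
  using assms(2-)
proof (induction "card (elts M)" arbitrary: M Z rule: less_induct)
  case less
  have M: "is_based_matrix M" "marking M \<rho>" using reduces_marking[OF less.prems(1)] by simp_all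
  have fin: "finite (elts M)" using M by (simp add: is_based_matrix_def)
  have Zb: "base M \<notin> Z" using removable_subset[OF less.prems(2)] by blast
  note MZ = based_delete[OF M(1) Zb]
  from less.prems(1) show ?case
  proof cases
    case (iso \<phi>)
    have "base M \<in> elts M" using M by (simp add: is_based_matrix_def)
    from marked_iso_removable(1)[OF iso(3) this less.prems(2)] show ?thesis
      using assms(1) by (simp add: irreducible_matrix_def)
  next
    case (step Y)
    have Yb: "base M \<notin> Y" "Y \<subseteq> elts M" "Y \<noteq> {}" using removable_subset[OF step(3)] by blast+
    have lt: "card (elts (delete M Y)) < card (elts M)"
      using Yb fin by (auto intro!: psubset_card_mono)
    have MY: "marking (delete M Y) \<rho>" using reduces_marking[OF step(4)] by simp
    from reduction_confluent[OF M step(3) MY less.prems(2,3)] show ?thesis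
    proof (rule disjE)
      assume "\<exists>\<phi>. marked_iso \<phi> (delete M Y) \<rho> (delete M Z) \<rho>"
      then show ?thesis using reduces_iso[OF step(4) _ MZ] by blast
    next
      assume *: "marking (delete M (Y \<union> Z)) \<rho> \<and> (Z \<subseteq> Y \<or> removable (delete M Y) (Z - Y)) \<and>
        (Y \<subseteq> Z \<or> removable (delete M Z) (Y - Z))"
      have "reduces P \<sigma> (delete M (Y \<union> Z)) \<rho>"
      proof (cases "Z \<subseteq> Y")
        case True
        then show ?thesis using step(4) by (simp add: Un_absorb2)
      next
        case False
        then show ?thesis
          using less.hyps[OF lt step(4), of "Z - Y"] * by simp
      qed
      then have r: "reduces P \<sigma> (delete (delete M Z) (Y - Z)) \<rho>" by (simp add: Un_commute)
      show ?thesis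
      proof (cases "Y \<subseteq> Z")
        case True
        then have "Y - Z = {}" by blast
        with r show ?thesis by simp
      next
        case False
        then show ?thesis using reduces.step[OF MZ less.prems(3) _ r] * by blast
      qed
    qed
  qed
qed

text \<open>Expressed for two matrices that agree on the smaller one, as a move on strings produces them. The
  implication from right to left is confluence, the other one is the definition.\<close>

lemma reduces_extension_iff:
  assumes P: "irreducible_matrix P"
    and M: "is_based_matrix M" "marking M \<rho>" and N: "is_based_matrix N" "marking N \<tau>"
    and ext: "elts N = elts M \<union> Z" "elts M \<inter> Z = {}" "base N = base M"
      "\<And>g h. g \<in> elts M \<Longrightarrow> h \<in> elts M \<Longrightarrow> form N g h = form M g h"
      "\<And>h. h \<in> elts M \<Longrightarrow> \<tau> h = \<rho> h"
    and Z: "removable N Z"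
  shows "reduces P \<sigma> M \<rho> \<longleftrightarrow> reduces P \<sigma> N \<tau>"
proof -
  have el: "elts (delete N Z) = elts M" using ext(1,2) by auto
  have iso: "marked_iso id M \<rho> (delete N Z) \<tau>"
    using ext el by (simp add: marked_iso_def)
  have b: "base M \<in> elts M" using M by (simp add: is_based_matrix_def)
  have based: "is_based_matrix (delete N Z)"
    using N removable_subset[OF Z] by (auto intro: based_delete)
  have mark: "marking (delete N Z) \<tau>" using marked_iso_marking[OF iso b M(2)] .
  have "reduces P \<sigma> M \<rho> \<longleftrightarrow> reduces P \<sigma> (delete N Z) \<tau>"
    using reduces_iso[OF _ iso based] reduces_iso[OF _ marked_iso_sym[OF iso b] M(1)] by blast
  also have "\<dots> \<longleftrightarrow> reduces P \<sigma> N \<tau>"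
    using reduces_delete[OF P _ Z mark] reduces.step[OF N Z] by blast
  finally show ?thesis .
qed

lemma reduces_embedding:
  assumes "reduces P \<sigma> M \<rho>" "base P \<in> elts P"
  shows "\<exists>\<psi>. \<psi> ` elts P \<subseteq> elts M \<and> \<psi> (base P) = base M \<and>
    (\<forall>g\<in>elts P. \<forall>h\<in>elts P. form M (\<psi> g) (\<psi> h) = form P g h) \<and>
    (\<forall>h\<in>elts P. \<rho> (\<psi> h) = \<sigma> h)"
  using assms
proof induction
  case (iso M \<rho> \<phi>)
  have b: "base M \<in> elts M" using iso by (simp add: is_based_matrix_def)
  from marked_iso_sym[OF iso.hyps(3) b]
  have "marked_iso (inv_into (elts M) \<phi>) P \<sigma> M \<rho>" .
  then show ?case
    unfolding marked_iso_def bij_betw_def by blast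
next
  case (step M \<rho> Z)
  from step.IH[OF step.prems] show ?case by auto
qed

text \<open>Two self-complementary elements both have half the row of \<open>s\<close> as their row, so they are
  complementary to each other.\<close>

lemma self_complementary_unique:
  assumes "irreducible_matrix P" "self_complementary P e" "self_complementary P f"
    "e \<noteq> base P" "f \<noteq> base P"
  shows "e = f"
proof (rule ccontr)
  assume "e \<noteq> f"
  moreover have "form P e h + form P f h = form P (base P) h" if "h \<in> elts P" for h
  proof -
    have "2 * form P e h = form P (base P) h" "2 * form P f h = form P (base P) h"
      using assms(2,3) that by (simp_all add: self_complementary_def)
    then show ?thesis by presburger
  qed
  ultimately have "complementary P e f"
    using assms by (auto simp: complementary_def self_complementary_def)
  then show False using assms(1) unfolding irreducible_matrix_def removable_def by blast
qed

lemma reduces_trivial_mark: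
  assumes r: "reduces P \<sigma> M \<rho>" and P: "base P \<in> elts P"
  shows "(\<forall>h\<in>elts M. \<rho> h = 0) \<Longrightarrow> h \<in> elts P \<Longrightarrow> \<sigma> h = 0"
    "(\<forall>h\<in>elts M. \<rho> h = form M (base M) h) \<Longrightarrow> h \<in> elts P \<Longrightarrow> \<sigma> h = form P (base P) h"
proof -
  obtain \<psi> where \<psi>: "\<psi> ` elts P \<subseteq> elts M" "\<psi> (base P) = base M"
    "\<And>g h. g \<in> elts P \<Longrightarrow> h \<in> elts P \<Longrightarrow> form M (\<psi> g) (\<psi> h) = form P g h"
    "\<And>h. h \<in> elts P \<Longrightarrow> \<rho> (\<psi> h) = \<sigma> h"
    using reduces_embedding[OF r P] by blast
  then have mem: "\<psi> h \<in> elts M" if "h \<in> elts P" for h using that by blast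
  show "\<sigma> h = 0" if "\<forall>h\<in>elts M. \<rho> h = 0" "h \<in> elts P"
    using \<psi>(4)[OF that(2)] mem[OF that(2)] that(1) by simp
  show "\<sigma> h = form P (base P) h" if "\<forall>h\<in>elts M. \<rho> h = form M (base M) h" "h \<in> elts P"
    using \<psi>(4)[OF that(2)] \<psi>(3)[OF P that(2)] mem[OF that(2)] that(1) \<psi>(2) by simp
qed

text \<open>A reduction of an irreducible matrix is an automorphism \<open>\<phi>\<close>. Here it makes \<open>\<phi> f\<close> and \<open>e\<close>
  satisfy the equation of complementary elements, which forces them to be equal. Then \<open>e = \<phi> f\<close> is
  self-complementary, hence so is \<open>f\<close>, and uniqueness gives \<open>e = f\<close>.\<close>

lemma irreducible_opposite_signs:
  assumes P: "irreducible_matrix P" "e \<in> elts P" "e \<noteq> base P" "f \<in> elts P" "f \<noteq> base P"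
    and r: "reduces P (form P e) P (\<lambda>h. form P (base P) h - form P f h)"
  shows "e = f \<and> self_complementary P e"
proof -
  from r obtain \<phi> where "is_based_matrix P"
    "marked_iso \<phi> P (\<lambda>h. form P (base P) h - form P f h) P (form P e)"
    by cases (use P(1) in \<open>auto simp: irreducible_matrix_def\<close>)
  then have \<phi>: "bij_betw \<phi> (elts P) (elts P)" "\<phi> (base P) = base P"
    "\<And>g h. g \<in> elts P \<Longrightarrow> h \<in> elts P \<Longrightarrow> form P (\<phi> g) (\<phi> h) = form P g h"
    "\<And>h. h \<in> elts P \<Longrightarrow> form P e (\<phi> h) = form P (base P) h - form P f h"
    by (simp_all add: marked_iso_def)
  have bP: "base P \<in> elts P" using \<open>is_based_matrix P\<close> by (simp add: is_based_matrix_def)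
  have surj: "\<exists>h\<in>elts P. k = \<phi> h" if "k \<in> elts P" for k
    using \<phi>(1) that by (auto simp: bij_betw_def)
  have mem: "\<phi> f \<in> elts P" using \<phi>(1) P(4) by (auto dest: bij_betwE)
  have ne: "\<phi> f \<noteq> base P"
    using \<phi>(1,2) bP P(4,5) by (metis bij_betw_iff_bijections)
  have sum: "form P e k + form P (\<phi> f) k = form P (base P) k" if k: "k \<in> elts P" for k
  proof -
    obtain h where h: "h \<in> elts P" "k = \<phi> h" using surj[OF k] by blast
    then show ?thesis
      using \<phi>(4)[OF h(1)] \<phi>(3)[OF P(4) h(1)] \<phi>(3)[OF bP h(1)] \<phi>(2) by simp
  qed
  have e: "e = \<phi> f"
  proof (rule ccontr)
    assume "e \<noteq> \<phi> f"
    then have "complementary P e (\<phi> f)"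
      using P mem ne sum by (auto simp: complementary_def)
    then show False using P(1) unfolding irreducible_matrix_def removable_def by blast
  qed
  have self_e: "self_complementary P e"
    using sum P e by (auto simp: self_complementary_def)
  have "form P f h + form P f h = form P (base P) h" if h: "h \<in> elts P" for h
  proof -
    have "\<phi> h \<in> elts P" using \<phi>(1) h by (auto dest: bij_betwE)
    then show ?thesis
      using sum[of "\<phi> h"] \<phi>(3)[OF P(4) h] \<phi>(3)[OF bP h] \<phi>(2) e by simp
  qed
  then have "self_complementary P f" using P by (auto simp: self_complementary_def)
  then show ?thesis using self_complementary_unique[OF P(1) self_e _ P(3,5)] self_e by blast
qed

lemma primitive_irreducible:
  assumes "primitive M"
  shows "irreducible_matrix M"
  unfolding irreducible_matrix_def
proof (intro allI notI)
  fix Z assume Z: "removable M Z"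
  have M: "is_based_matrix M" using assms by (simp add: primitive_def)
  have sub: "Z \<subseteq> elts M - {base M}" using removable_subset[OF Z] by blast
  then have "is_based_matrix (delete M Z)" using M by (intro based_delete) auto
  with M sub have ext: "extends M (delete M Z) Z" by (auto simp: extends_def)
  from Z ext have "elem_ext (delete M Z) M"
    unfolding removable_def by (auto intro: elem_ext.intros)
  then show False using assms by (auto simp: primitive_def)
qed

section \<open>The based matrix as a skew form on functions\<close>

text \<open>Membership in arcs becomes linear arithmetic in the angles of the points. All statements below on
  the cyclic order of a few points are obtained from this.\<close>

lemma in_open_circle_arc_iff:
  assumes "x \<in> circle" "y \<in> circle" "z \<in> circle"
  shows "z \<in> open_circle_arc x y \<longleftrightarrow>
    (if Arg2pi x \<le> Arg2pi y then Arg2pi x < Arg2pi z \<and> Arg2pi z < Arg2pi y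
     else Arg2pi x < Arg2pi z \<or> Arg2pi z < Arg2pi y)"
proof -
  have nz: "x \<noteq> 0" "y \<noteq> 0" "z \<noteq> 0" using assms by auto
  have b: "Arg2pi x < 2 * pi" "0 \<le> Arg2pi x" for x
    by (simp_all add: Arg2pi_lt_2pi Arg2pi_ge_0)
  show ?thesis
    using nz assms(3) b[of x] b[of y] b[of z]
    by (auto simp: open_circle_arc_def Arg2pi_divide_cases)
qed

lemma Arg2pi_circle_inj:
  assumes "x \<in> circle" "y \<in> circle" "Arg2pi x = Arg2pi y"
  shows "x = y"
  using assms Arg2pi_eq[of x] Arg2pi_eq[of y] by simp

lemma circle_arc_eq:
  assumes "x \<in> circle" "y \<in> circle" "x \<noteq> y"
  shows "circle_arc x y = insert x (insert y (open_circle_arc x y))"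
proof -
  have nz: "x \<noteq> 0" "y \<noteq> 0" using assms by auto
  have b: "Arg2pi x < 2 * pi" "0 \<le> Arg2pi x" for x
    by (simp_all add: Arg2pi_lt_2pi Arg2pi_ge_0)
  have "z \<in> circle_arc x y \<longleftrightarrow> z = x \<or> z = y \<or> z \<in> open_circle_arc x y" if z: "z \<in> circle" for z
  proof -
    have nz': "z \<noteq> 0" using z by auto
    have i: "Arg2pi x = Arg2pi y \<longleftrightarrow> x = y" "Arg2pi x = Arg2pi z \<longleftrightarrow> x = z" "Arg2pi y = Arg2pi z \<longleftrightarrow> y = z"
      using Arg2pi_circle_inj assms z by blast+
    show ?thesis
      unfolding in_open_circle_arc_iff[OF assms(1,2) z]
      using nz nz' z i assms(3) b[of x] b[of y] b[of z]
      by (simp add: circle_arc_def Arg2pi_divide_cases) (smt (verit))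
  qed
  then show ?thesis using assms by (auto simp: circle_arc_def open_circle_arc_def)
qed

lemma open_circle_arc_complement:
  assumes "x \<in> circle" "y \<in> circle" "z \<in> circle" "z \<noteq> x" "z \<noteq> y" "x \<noteq> y"
  shows "z \<in> open_circle_arc y x \<longleftrightarrow> z \<notin> open_circle_arc x y"
proof -
  have i: "Arg2pi x \<noteq> Arg2pi y" "Arg2pi x \<noteq> Arg2pi z" "Arg2pi y \<noteq> Arg2pi z"
    using Arg2pi_circle_inj assms by blast+
  then show ?thesis
    using in_open_circle_arc_iff[of x y z] in_open_circle_arc_iff[of y x z] assms by auto
qed

lemma gap_same_side:
  assumes "{x, y, u, v} \<subseteq> circle" "{u, v} \<inter> {x, y} = {}" "open_circle_arc x y \<inter> {u, v} = {}"
  shows "x \<in> open_circle_arc u v \<longleftrightarrow> y \<in> open_circle_arc u v"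
proof -
  have c: "x \<in> circle" "y \<in> circle" "u \<in> circle" "v \<in> circle" using assms(1) by auto
  have ne: "x \<noteq> u" "x \<noteq> v" "y \<noteq> u" "y \<noteq> v" using assms by auto
  have i: "Arg2pi x \<noteq> Arg2pi u" "Arg2pi x \<noteq> Arg2pi v" "Arg2pi y \<noteq> Arg2pi u" "Arg2pi y \<noteq> Arg2pi v"
    using Arg2pi_circle_inj c ne by blast+
  have "u \<notin> open_circle_arc x y" "v \<notin> open_circle_arc x y" using assms(3) by auto
  then show ?thesis
    using i unfolding in_open_circle_arc_iff[OF c(1,2,3)] in_open_circle_arc_iff[OF c(1,2,4)]
      in_open_circle_arc_iff[OF c(3,4,1)] in_open_circle_arc_iff[OF c(3,4,2)]
    by (simp split: if_splits) linarith?
qed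

text \<open>The function \<open>w\<^sub>g\<close> of the introduction; \<open>None\<close> is the base element \<open>s\<close>.\<close>

definition weight :: "arrow option \<Rightarrow> complex \<Rightarrow> real" where
  "weight g z = (case g of None \<Rightarrow> 1 | Some e \<Rightarrow>
     if z \<in> ends e then 1 / 2 else of_bool (z \<in> open_circle_arc (fst e) (snd e)))"

definition arrow_pairing :: "arrow set \<Rightarrow> (complex \<Rightarrow> real) \<Rightarrow> (complex \<Rightarrow> real) \<Rightarrow> real" where
  "arrow_pairing A \<phi> \<psi> = (\<Sum>(x, y)\<in>A. \<phi> x * \<psi> y - \<psi> x * \<phi> y)"

lemma weight_None [simp]: "weight None z = 1"
  by (simp add: weight_def)

lemma weight_Some: "weight (Some (a, b)) z =
    (if z = a \<or> z = b then 1 / 2 else of_bool (z \<in> open_circle_arc a b))"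
  by (simp add: weight_def ends_def)

lemma pairing_skew: "arrow_pairing A \<phi> \<psi> = - arrow_pairing A \<psi> \<phi>"
  by (simp add: arrow_pairing_def sum_negf[symmetric] case_prod_unfold)

lemma pairing_add: "arrow_pairing A (\<lambda>z. \<phi> z + \<psi> z) \<theta> = arrow_pairing A \<phi> \<theta> + arrow_pairing A \<psi> \<theta>"
  by (simp add: arrow_pairing_def sum.distrib[symmetric] case_prod_unfold algebra_simps)

lemma pairing_diff: "arrow_pairing A (\<lambda>z. \<phi> z - \<psi> z) \<theta> = arrow_pairing A \<phi> \<theta> - arrow_pairing A \<psi> \<theta>"
  by (simp add: arrow_pairing_def sum_subtractf[symmetric] case_prod_unfold algebra_simps)

lemma pairing_add_right: "arrow_pairing A \<theta> (\<lambda>z. \<phi> z + \<psi> z) = arrow_pairing A \<theta> \<phi> + arrow_pairing A \<theta> \<psi>"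
  using pairing_add[of A \<phi> \<psi> \<theta>] pairing_skew[of A \<theta> \<phi>] pairing_skew[of A \<theta> \<psi>]
    pairing_skew[of A \<theta> "\<lambda>z. \<phi> z + \<psi> z"] by simp

lemma pairing_cong:
  assumes "\<And>x y. (x, y) \<in> A \<Longrightarrow> \<phi> x = \<phi>' x \<and> \<phi> y = \<phi>' y \<and> \<psi> x = \<psi>' x \<and> \<psi> y = \<psi>' y"
  shows "arrow_pairing A \<phi> \<psi> = arrow_pairing A \<phi>' \<psi>'"
  unfolding arrow_pairing_def by (rule sum.cong) (use assms in \<open>auto\<close>)

lemma pairing_support:
  assumes "finite A" "S \<subseteq> A" "\<And>x y. (x, y) \<in> A - S \<Longrightarrow> \<phi> x = 0 \<and> \<phi> y = 0"
  shows "arrow_pairing A \<phi> \<psi> = arrow_pairing S \<phi> \<psi>"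
  unfolding arrow_pairing_def
  by (rule sum.mono_neutral_right) (use assms in auto)

lemma pairing_insert:
  "finite A \<Longrightarrow> (x, y) \<notin> A \<Longrightarrow>
    arrow_pairing (insert (x, y) A) \<phi> \<psi> = \<phi> x * \<psi> y - \<psi> x * \<phi> y + arrow_pairing A \<phi> \<psi>"
  by (simp add: arrow_pairing_def)

lemma pairing_empty [simp]: "arrow_pairing {} \<phi> \<psi> = 0"
  by (simp add: arrow_pairing_def)

lemma pairing_image:
  assumes "inj_on (map_prod h h) A"
  shows "arrow_pairing (map_prod h h ` A) \<phi> \<psi> = arrow_pairing A (\<phi> \<circ> h) (\<psi> \<circ> h)"
  using assms by (simp add: arrow_pairing_def sum.reindex case_prod_unfold)

lemma arrow_cases:
  assumes "e \<in> arr \<alpha>" "(x, y) \<in> arr \<alpha>"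
  shows "(x, y) = e \<or> x \<notin> ends e \<and> y \<notin> ends e"
  using arr_disjoint[OF assms(2,1), of x] arr_disjoint[OF assms(2,1), of y] by (auto simp: ends_def)

abbreviation arc_indicator :: "arrow \<Rightarrow> complex \<Rightarrow> real" where
  "arc_indicator e z \<equiv> of_bool (z \<in> open_circle_arc (fst e) (snd e))"

lemma card_as_sum:
  assumes "finite A"
  shows "real (card {u \<in> A. P u}) = (\<Sum>u\<in>A. of_bool (P u))"
  using assms by (simp add: Int_def)

lemma arc_dot_pairing:
  "real_of_int (arc_dot \<alpha> e f) = arrow_pairing (arr \<alpha>) (arc_indicator e) (arc_indicator f)"
proof -
  obtain a b c d where [simp]: "e = (a, b)" "f = (c, d)" by fastforce
  have s: "{(x, y). (x, y) \<in> arr \<alpha> \<and> x \<in> X \<and> y \<in> Y} = {u \<in> arr \<alpha>. fst u \<in> X \<and> snd u \<in> Y}" for X Y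
    by auto
  have card: "real (card {u \<in> arr \<alpha>. P u \<and> Q u}) = (\<Sum>u\<in>arr \<alpha>. of_bool (P u) * of_bool (Q u))" for P Q
    by (subst card_as_sum) (simp_all only: finite_arr of_bool_conj)
  show ?thesis
    unfolding arrow_pairing_def case_prod_unfold sum_subtractf
    by (simp add: s card del: sum_of_bool_mult_eq sum_mult_of_bool_eq)
qed

lemma link_sign_indicator:
  assumes "e \<in> arr \<alpha>" "f \<in> arr \<alpha>"
  shows "real_of_int (link_sign e f) = arc_indicator e (fst f) - arc_indicator e (snd f)"
proof -
  obtain a b c d where ef [simp]: "e = (a, b)" "f = (c, d)" by fastforce
  show ?thesis
  proof (cases "e = f")
    case True
    then show ?thesis using open_circle_arc_ends by (simp add: link_sign_def)
  next
    case False
    then have "c \<noteq> a" "c \<noteq> b" "d \<noteq> a" "d \<noteq> b"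
      using arrow_cases[OF assms(1), of c d] assms(2) by (auto simp: ends_def)
    moreover have "a \<in> circle" "b \<in> circle" "c \<in> circle" "d \<in> circle" "a \<noteq> b"
      using assms arr_circle by auto
    ultimately have "c \<in> open_circle_arc b a \<longleftrightarrow> c \<notin> open_circle_arc a b"
      "d \<in> open_circle_arc b a \<longleftrightarrow> d \<notin> open_circle_arc a b"
      using open_circle_arc_complement by blast+
    then show ?thesis by (auto simp: link_sign_def)
  qed
qed

lemma links_exclusive:
  assumes "e \<in> arr \<alpha>" "f \<in> arr \<alpha>"
  shows "\<not> (links_pos e f \<and> links_neg e f)"
proof
  assume *: "links_pos e f \<and> links_neg e f"
  obtain a b c d where ef [simp]: "e = (a, b)" "f = (c, d)" by fastforce
  have c: "c \<in> open_circle_arc a b" "c \<in> open_circle_arc b a" using * by simp_all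
  then have "c \<noteq> a" "c \<noteq> b" using open_circle_arc_ends by metis+
  moreover have "a \<in> circle" "b \<in> circle" "c \<in> circle" "a \<noteq> b"
    using assms arr_circle by auto
  ultimately show False using c open_circle_arc_complement by metis
qed

lemma link_sign_skew:
  assumes "e \<in> arr \<alpha>" "f \<in> arr \<alpha>"
  shows "link_sign e f = - link_sign f e"
proof -
  have "T_form \<alpha> (Some e) (Some f) = - T_form \<alpha> (Some f) (Some e)"
    using T_matrix_based[of \<alpha>] assms unfolding is_based_matrix_def T_matrix_def based_matrix.simps by blast
  moreover have "arc_dot \<alpha> e f = - arc_dot \<alpha> f e" by (cases e; cases f) simp
  ultimately show ?thesis by simp
qed

lemma weight_split:
  assumes "e \<in> arr \<alpha>"
  shows "weight (Some e) z = arc_indicator e z + of_bool (z \<in> ends e) / 2"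
  using open_circle_arc_ends by (cases e) (auto simp: weight_Some ends_def)

lemma pairing_ends:
  assumes "e \<in> arr \<alpha>"
  shows "arrow_pairing (arr \<alpha>) (\<lambda>z. of_bool (z \<in> ends e) / 2) \<psi> = (\<psi> (snd e) - \<psi> (fst e)) / 2"
proof -
  have "arrow_pairing (arr \<alpha>) (\<lambda>z. of_bool (z \<in> ends e) / 2) \<psi>
      = arrow_pairing {e} (\<lambda>z. of_bool (z \<in> ends e) / 2) \<psi>"
    by (rule pairing_support) (use assms arrow_cases[OF assms] in auto)
  also have "\<dots> = (\<psi> (snd e) - \<psi> (fst e)) / 2"
    by (cases e) (simp add: arrow_pairing_def ends_def diff_divide_distrib)
  finally show ?thesis .
qed

text \<open>Expanding \<open>w\<^sub>e\<close> as the indicator of the open arc plus half the indicator of the two ends, the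
  indicators contribute \<open>ab \<cdot> cd\<close>. Among the mixed terms only the arrows \<open>e\<close> and \<open>f\<close> count,
  each contributing half of the linking sign, and the terms with both indicators of ends cancel.\<close>

lemma T_form_pairing:
  assumes g: "g \<in> insert None (Some ` arr \<alpha>)" and h: "h \<in> insert None (Some ` arr \<alpha>)"
  shows "real_of_int (T_form \<alpha> g h) = arrow_pairing (arr \<alpha>) (weight g) (weight h)"
proof -
  have W: "weight (Some e) = (\<lambda>z. arc_indicator e z + of_bool (z \<in> ends e) / 2)" if "e \<in> arr \<alpha>" for e
    using weight_split[OF that] by blast
  have I0: "arc_indicator e (fst e) = 0" "arc_indicator e (snd e) = 0" for e
    using open_circle_arc_ends by simp_all
  have n: "real_of_int (link_index \<alpha> e) = arrow_pairing (arr \<alpha>) (weight (Some e)) (weight None)"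
    if e: "e \<in> arr \<alpha>" for e
  proof -
    have "real_of_int (link_index \<alpha> e) = (\<Sum>u\<in>arr \<alpha>. of_bool (links_pos e u) - of_bool (links_neg e u))"
      by (simp add: link_index_def card_as_sum sum_subtractf)
    also have "\<dots> = (\<Sum>u\<in>arr \<alpha>. real_of_int (link_sign e u))"
      using links_exclusive[OF e] by (intro sum.cong refl) (simp add: link_sign_def del: links_pos.simps links_neg.simps)
    also have "\<dots> = arrow_pairing (arr \<alpha>) (arc_indicator e) (\<lambda>_. 1)"
      using link_sign_indicator[OF e] by (simp add: arrow_pairing_def case_prod_unfold)
    also have "\<dots> = arrow_pairing (arr \<alpha>) (weight (Some e)) (\<lambda>_. 1)"
      unfolding W[OF e] pairing_add pairing_ends[OF e] by simp
    also have "(\<lambda>_. 1) = weight None" by auto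
    finally show ?thesis .
  qed
  have ef: "real_of_int (arc_dot \<alpha> e f + link_sign e f)
      = arrow_pairing (arr \<alpha>) (weight (Some e)) (weight (Some f))"
    if e: "e \<in> arr \<alpha>" and f: "f \<in> arr \<alpha>" for e f
  proof -
    have "arrow_pairing (arr \<alpha>) (weight (Some e)) (weight (Some f))
      = arrow_pairing (arr \<alpha>) (arc_indicator e) (weight (Some f))
        + (weight (Some f) (snd e) - weight (Some f) (fst e)) / 2"
      by (subst W[OF e], subst pairing_add, subst pairing_ends[OF e]) simp
    also have "arrow_pairing (arr \<alpha>) (arc_indicator e) (weight (Some f))
      = arrow_pairing (arr \<alpha>) (arc_indicator e) (arc_indicator f)
        - (arc_indicator e (snd f) - arc_indicator e (fst f)) / 2"
      using pairing_skew[of "arr \<alpha>" "arc_indicator e" "\<lambda>z. of_bool (z \<in> ends f) / 2"]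
      by (subst W[OF f], subst pairing_add_right) (simp add: pairing_ends[OF f])
    also have "weight (Some f) (snd e) - weight (Some f) (fst e)
       = arc_indicator f (snd e) - arc_indicator f (fst e)"
    proof (cases "e = f")
      case True
      then show ?thesis using I0 by (simp add: weight_def ends_def)
    next
      case False
      then have "fst e \<notin> ends f" "snd e \<notin> ends f"
        using arrow_cases[OF f, of "fst e" "snd e"] e by auto
      then show ?thesis by (simp add: weight_def)
    qed
    also have "arc_indicator f (snd e) - arc_indicator f (fst e)
        = arc_indicator e (fst f) - arc_indicator e (snd f)"
      using link_sign_indicator[OF e f] link_sign_indicator[OF f e] link_sign_skew[OF e f] by simp
    finally show ?thesis
      using link_sign_indicator[OF e f] by (simp add: arc_dot_pairing field_simps)
  qed
  show ?thesis
    using g h n ef pairing_skew[of "arr \<alpha>" "weight None" "weight h"]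
    by (cases g; cases h) (auto simp del: weight_None)
qed

section \<open>The effect of the moves on the based matrix\<close>

lemma elts_T_matrix [simp]: "elts (T_matrix \<alpha>) = insert None (Some ` arr \<alpha>)"
  and base_T_matrix [simp]: "base (T_matrix \<alpha>) = None"
  and form_T_matrix [simp]: "form (T_matrix \<alpha>) = T_form \<alpha>"
  by (simp_all add: T_matrix_def)

lemma T_form_eqI:
  assumes "g \<in> insert None (Some ` arr \<alpha>)" "h \<in> insert None (Some ` arr \<alpha>)"
    and "g' \<in> insert None (Some ` arr \<beta>)" "h' \<in> insert None (Some ` arr \<beta>)"
    and "arrow_pairing (arr \<beta>) (weight g') (weight h') = arrow_pairing (arr \<alpha>) (weight g) (weight h)"
  shows "T_form \<beta> g' h' = T_form \<alpha> g h"
  using T_form_pairing[OF assms(1,2)] T_form_pairing[OF assms(3,4)] assms(5)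
  by (metis of_int_eq_iff)

lemma endpoints_circle: "x \<in> endpoints \<alpha> \<Longrightarrow> x \<in> circle"
  using arr_circle by (fastforce simp: endpoints_def ends_def)

text \<open>The reason why new arrows with neighbouring end points do not disturb the form of the old ones.\<close>

lemma weight_gap:
  assumes "x \<in> circle" "y \<in> circle" "g \<in> insert None (Some ` arr \<alpha>)"
    and gap: "open_circle_arc x y \<inter> endpoints \<alpha> = {}"
    and away: "\<And>e. g = Some e \<Longrightarrow> x \<notin> ends e \<and> y \<notin> ends e"
  shows "weight g x = weight g y"
proof (cases g)
  case (Some e)
  obtain u v where e: "e = (u, v)" by fastforce
  then have uv: "(u, v) \<in> arr \<alpha>" using Some assms(3) by auto
  then have "{u, v} \<subseteq> endpoints \<alpha>" using endpoints_in by blast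
  then have "open_circle_arc x y \<inter> {u, v} = {}" using gap by blast
  moreover have "u \<noteq> x" "u \<noteq> y" "v \<noteq> x" "v \<noteq> y" using away[OF Some] by (auto simp: e ends_def)
  moreover have "{x, y, u, v} \<subseteq> circle" using assms(1,2) arr_circle[OF uv] by simp
  ultimately have "x \<in> open_circle_arc u v \<longleftrightarrow> y \<in> open_circle_arc u v"
    by (intro gap_same_side) auto
  then show ?thesis using away[OF Some] by (simp add: weight_def Some e)
qed simp

text \<open>The weight of such an arrow vanishes at all other end points, so only the arrow itself contributes
  to its row. This contribution is half the difference of \<open>w\<^sub>h\<close> at its two ends, which is 0.\<close>

lemma free_arc_annihilating:
  assumes ab: "(a, b) \<in> arr \<alpha>" and gap: "open_circle_arc a b \<inter> endpoints \<alpha> = {}"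
  shows "annihilating (T_matrix \<alpha>) (Some (a, b))"
proof -
  have c: "a \<in> circle" "b \<in> circle" using arr_circle[OF ab] by auto
  have "T_form \<alpha> (Some (a, b)) h = 0" if h: "h \<in> insert None (Some ` arr \<alpha>)" for h
  proof -
    have "arrow_pairing (arr \<alpha>) (weight (Some (a, b))) (weight h)
      = arrow_pairing {(a, b)} (weight (Some (a, b))) (weight h)"
    proof (rule pairing_support)
      fix x y assume xy: "(x, y) \<in> arr \<alpha> - {(a, b)}"
      then have "x \<notin> ends (a, b) \<and> y \<notin> ends (a, b)" using arrow_cases[OF ab, of x y] by auto
      moreover have "x \<notin> open_circle_arc a b \<and> y \<notin> open_circle_arc a b"
        using xy gap endpoints_in[of x y \<alpha>] by auto
      ultimately show "weight (Some (a, b)) x = 0 \<and> weight (Some (a, b)) y = 0"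
        by (simp add: weight_def)
    qed (use ab in auto)
    also have "\<dots> = (weight h b - weight h a) / 2"
      by (simp add: arrow_pairing_def weight_Some diff_divide_distrib)
    also have "weight h a = weight h b"
    proof (cases "h = Some (a, b)")
      case False
      then show ?thesis
        using h ab arrow_cases[of _ \<alpha> a b] by (intro weight_gap[OF c h gap]) auto
    qed (simp add: weight_Some)
    finally show ?thesis using T_form_pairing[of "Some (a, b)" \<alpha> h] ab h by simp
  qed
  then show ?thesis using ab by (simp add: annihilating_def)
qed

text \<open>As before, for the difference of the weights of the arrow and of \<open>s\<close>.\<close>

lemma free_arc_core:
  assumes ab: "(a, b) \<in> arr \<alpha>" and gap: "open_circle_arc b a \<inter> endpoints \<alpha> = {}"
  shows "core (T_matrix \<alpha>) (Some (a, b))"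
proof -
  have c: "a \<in> circle" "b \<in> circle" "a \<noteq> b" using arr_circle[OF ab] by auto
  have "T_form \<alpha> (Some (a, b)) h = T_form \<alpha> None h" if h: "h \<in> insert None (Some ` arr \<alpha>)" for h
  proof -
    let ?\<delta> = "\<lambda>z. weight (Some (a, b)) z - weight None z"
    have "arrow_pairing (arr \<alpha>) ?\<delta> (weight h) = arrow_pairing {(a, b)} ?\<delta> (weight h)"
    proof (rule pairing_support)
      fix x y assume xy: "(x, y) \<in> arr \<alpha> - {(a, b)}"
      then have n: "x \<notin> ends (a, b)" "y \<notin> ends (a, b)" using arrow_cases[OF ab, of x y] by auto
      have "x \<notin> open_circle_arc b a" "y \<notin> open_circle_arc b a"
        using xy gap endpoints_in[of x y \<alpha>] by auto
      then have "x \<in> open_circle_arc a b" "y \<in> open_circle_arc a b"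
        using open_circle_arc_complement[of b a x] open_circle_arc_complement[of b a y] c n
          arr_circle[of x y \<alpha>] xy by (auto simp: ends_def)
      then show "?\<delta> x = 0 \<and> ?\<delta> y = 0" using n by (simp add: weight_def)
    qed (use ab in auto)
    also have "\<dots> = (weight h a - weight h b) / 2"
      by (simp add: arrow_pairing_def weight_Some diff_divide_distrib)
    also have "weight h a = weight h b"
    proof (cases "h = Some (a, b)")
      case False
      then show ?thesis
        using h ab arrow_cases[of _ \<alpha> a b] by (intro weight_gap[OF c(2,1) h gap, symmetric]) auto
    qed (simp add: weight_Some)
    finally have "arrow_pairing (arr \<alpha>) ?\<delta> (weight h) = 0" by simp
    then show ?thesis
      using T_form_pairing[of "Some (a, b)" \<alpha> h] T_form_pairing[of None \<alpha> h] ab h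
      unfolding pairing_diff by (simp del: weight_None)
  qed
  then show ?thesis using ab by (simp add: core_def)
qed

text \<open>Up to the two short arcs, the arcs of the arrows \<open>(a, b)\<close> and \<open>(b', a')\<close> are complementary.\<close>

lemma parallel_arrows_order:
  assumes c: "{a, a', b, b', z} \<subseteq> circle" and d: "distinct [a, a', b, b', z]"
    and ga: "open_circle_arc a a' \<inter> {b, b', z} = {} \<or> open_circle_arc a' a \<inter> {b, b', z} = {}"
    and gb: "open_circle_arc b b' \<inter> {a, a', z} = {} \<or> open_circle_arc b' b \<inter> {a, a', z} = {}"
  shows "z \<in> open_circle_arc a b \<longleftrightarrow> z \<notin> open_circle_arc b' a'"
proof -
  have c': "a \<in> circle" "a' \<in> circle" "b \<in> circle" "b' \<in> circle" "z \<in> circle" using c by auto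
  have i: "Arg2pi a \<noteq> Arg2pi a'" "Arg2pi a \<noteq> Arg2pi b" "Arg2pi a \<noteq> Arg2pi b'" "Arg2pi a \<noteq> Arg2pi z"
    "Arg2pi a' \<noteq> Arg2pi b" "Arg2pi a' \<noteq> Arg2pi b'" "Arg2pi a' \<noteq> Arg2pi z"
    "Arg2pi b \<noteq> Arg2pi b'" "Arg2pi b \<noteq> Arg2pi z" "Arg2pi b' \<noteq> Arg2pi z"
    using d Arg2pi_circle_inj c' by auto
  note r = in_open_circle_arc_iff[OF c'(1,2)] in_open_circle_arc_iff[OF c'(2,1)]
    in_open_circle_arc_iff[OF c'(3,4)] in_open_circle_arc_iff[OF c'(4,3)]
    in_open_circle_arc_iff[OF c'(1,3)] in_open_circle_arc_iff[OF c'(4,2)]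
  have "b \<notin> open_circle_arc a a' \<and> b' \<notin> open_circle_arc a a' \<and> z \<notin> open_circle_arc a a' \<or>
    b \<notin> open_circle_arc a' a \<and> b' \<notin> open_circle_arc a' a \<and> z \<notin> open_circle_arc a' a"
    "a \<notin> open_circle_arc b b' \<and> a' \<notin> open_circle_arc b b' \<and> z \<notin> open_circle_arc b b' \<or>
    a \<notin> open_circle_arc b' b \<and> a' \<notin> open_circle_arc b' b \<and> z \<notin> open_circle_arc b' b"
    using ga gb by auto
  then show ?thesis
    using i unfolding r[OF c'(1)] r[OF c'(2)] r[OF c'(3)] r[OF c'(4)] r[OF c'(5)]
    by (smt (verit))
qed

text \<open>The same comparison at the ends of the short arcs: it depends only on which of \<open>a\<close>, \<open>a'\<close>,
  respectively of \<open>b\<close>, \<open>b'\<close>, comes first.\<close>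

lemma parallel_arrows_order':
  assumes c: "{a, a', b, b'} \<subseteq> circle" and d: "distinct [a, a', b, b']"
    and ga: "open_circle_arc a a' \<inter> {b, b'} = {} \<or> open_circle_arc a' a \<inter> {b, b'} = {}"
    and gb: "open_circle_arc b b' \<inter> {a, a'} = {} \<or> open_circle_arc b' b \<inter> {a, a'} = {}"
  shows "a' \<in> open_circle_arc a b \<longleftrightarrow> a \<in> open_circle_arc b' a'"
    "b' \<in> open_circle_arc a b \<longleftrightarrow> b \<in> open_circle_arc b' a'"
proof -
  have c': "a \<in> circle" "a' \<in> circle" "b \<in> circle" "b' \<in> circle" using c by auto
  have i: "Arg2pi a \<noteq> Arg2pi a'" "Arg2pi a \<noteq> Arg2pi b" "Arg2pi a \<noteq> Arg2pi b'"
    "Arg2pi a' \<noteq> Arg2pi b" "Arg2pi a' \<noteq> Arg2pi b'" "Arg2pi b \<noteq> Arg2pi b'"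
    using d Arg2pi_circle_inj c' by auto
  note r = in_open_circle_arc_iff[OF c'(1,2)] in_open_circle_arc_iff[OF c'(2,1)]
    in_open_circle_arc_iff[OF c'(3,4)] in_open_circle_arc_iff[OF c'(4,3)]
    in_open_circle_arc_iff[OF c'(1,3)] in_open_circle_arc_iff[OF c'(4,2)]
  have "b \<notin> open_circle_arc a a' \<and> b' \<notin> open_circle_arc a a' \<or>
    b \<notin> open_circle_arc a' a \<and> b' \<notin> open_circle_arc a' a"
    "a \<notin> open_circle_arc b b' \<and> a' \<notin> open_circle_arc b b' \<or>
    a \<notin> open_circle_arc b' b \<and> a' \<notin> open_circle_arc b' b"
    using ga gb by auto
  then show "a' \<in> open_circle_arc a b \<longleftrightarrow> a \<in> open_circle_arc b' a'"
    "b' \<in> open_circle_arc a b \<longleftrightarrow> b \<in> open_circle_arc b' a'"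
    using i unfolding r[OF c'(1)] r[OF c'(2)] r[OF c'(3)] r[OF c'(4)]
    by (smt (verit))+
qed

text \<open>Let \<open>\<delta>\<close> be the sum of the two weights minus 1. It vanishes at all end points other than those of
  the two arrows, and takes a common value \<open>p\<close> at \<open>a, a'\<close> and \<open>q\<close> at \<open>b, b'\<close>. Hence its pairing
  with \<open>\<psi>\<close> is \<open>p (\<psi> b - \<psi> b') + q (\<psi> a' - \<psi> a)\<close>. This vanishes for the weight of any other
  element, which cannot separate the short arcs. For the weights of the two arrows themselves it is
  \<open>q p - p q\<close>, up to sign.\<close>

lemma parallel_complementary:
  assumes ab: "{a, a'} = {x, y}" "{b, b'} = {z, w}"
    and disj: "circle_arc x y \<inter> circle_arc z w = {}"
    and gap: "open_circle_arc x y \<inter> endpoints \<alpha> = {}" "open_circle_arc z w \<inter> endpoints \<alpha> = {}"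
    and arrows: "(a, b) \<in> arr \<alpha>" "(b', a') \<in> arr \<alpha>"
  shows "complementary (T_matrix \<alpha>) (Some (a, b)) (Some (b', a'))"
proof -
  let ?e = "(a, b)" and ?e' = "(b', a')"
  have c: "a \<in> circle" "b \<in> circle" "a' \<in> circle" "b' \<in> circle"
    using arr_circle[OF arrows(1)] arr_circle[OF arrows(2)] by auto
  then have xyzw: "x \<in> circle" "y \<in> circle" "z \<in> circle" "w \<in> circle" using ab by (auto simp: doubleton_eq_iff)
  have sub: "{a, a'} \<subseteq> circle_arc x y" "{b, b'} \<subseteq> circle_arc z w"
    unfolding ab using circle_arc_ends xyzw by auto
  have ne: "a \<noteq> b" "a \<noteq> b'" "a' \<noteq> b" "a' \<noteq> b'" using sub disj by auto
  have aa: "a \<noteq> a'" "b \<noteq> b'"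
    using arr_disjoint[OF arrows, of a] arr_disjoint[OF arrows, of b] ne by (auto simp: ends_def)
  have ep: "{a, a', b, b'} \<subseteq> endpoints \<alpha>" using arrows endpoints_in by blast
  have gap_a: "open_circle_arc a a' \<inter> endpoints \<alpha> = {} \<or> open_circle_arc a' a \<inter> endpoints \<alpha> = {}"
    using ab(1) gap(1) by (auto simp: doubleton_eq_iff)
  have gap_b: "open_circle_arc b b' \<inter> endpoints \<alpha> = {} \<or> open_circle_arc b' b \<inter> endpoints \<alpha> = {}"
    using ab(2) gap(2) by (auto simp: doubleton_eq_iff)
  have ee': "?e \<noteq> ?e'" using ne by auto
  have dist: "distinct [a, a', b, b']" using ne aa by auto
  define p where "p = weight (Some ?e) a' - 1 / 2"
  define q where "q = weight (Some ?e) b' - 1 / 2"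
  have order: "a' \<in> open_circle_arc a b \<longleftrightarrow> a \<in> open_circle_arc b' a'"
    "b' \<in> open_circle_arc a b \<longleftrightarrow> b \<in> open_circle_arc b' a'"
    by (rule parallel_arrows_order'; use c dist gap_a gap_b ep in blast)+
  have we: "weight (Some ?e) a = 1 / 2" "weight (Some ?e) b = 1 / 2"
    "weight (Some ?e) a' = p + 1 / 2" "weight (Some ?e) b' = q + 1 / 2"
    by (simp_all add: weight_Some p_def q_def)
  have we': "weight (Some ?e') a' = 1 / 2" "weight (Some ?e') b' = 1 / 2"
    "weight (Some ?e') a = p + 1 / 2" "weight (Some ?e') b = q + 1 / 2"
    using ne aa order by (simp_all add: weight_Some p_def q_def)
  let ?\<delta> = "\<lambda>v. (weight (Some ?e) v + weight (Some ?e') v) - weight None v"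
  have away: "z \<notin> {a, b, a', b'}" if "(z, z') \<in> arr \<alpha> - {?e, ?e'} \<or> (z', z) \<in> arr \<alpha> - {?e, ?e'}" for z z'
    using that arrow_cases[OF arrows(1), of z z'] arrow_cases[OF arrows(2), of z z']
      arrow_cases[OF arrows(1), of z' z] arrow_cases[OF arrows(2), of z' z] by (auto simp: ends_def)
  have zero: "?\<delta> z = 0" if z: "z \<notin> {a, b, a', b'}" "z \<in> endpoints \<alpha>" for z
  proof -
    have "z \<in> open_circle_arc a b \<longleftrightarrow> z \<notin> open_circle_arc b' a'"
    proof (rule parallel_arrows_order)
      show "{a, a', b, b', z} \<subseteq> circle" using c endpoints_circle[OF z(2)] by auto
      show "distinct [a, a', b, b', z]" using dist z(1) by auto
    qed (use gap_a gap_b ep z in blast)+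
    then show ?thesis using z by (simp add: weight_Some)
  qed
  have pair: "arrow_pairing (arr \<alpha>) ?\<delta> \<psi> = p * (\<psi> b - \<psi> b') + q * (\<psi> a' - \<psi> a)" for \<psi>
  proof -
    have "arrow_pairing (arr \<alpha>) ?\<delta> \<psi> = arrow_pairing {?e, ?e'} ?\<delta> \<psi>"
    proof (rule pairing_support)
      fix u v assume uv: "(u, v) \<in> arr \<alpha> - {?e, ?e'}"
      then have "u \<in> endpoints \<alpha>" "v \<in> endpoints \<alpha>" using endpoints_in by blast+
      then show "?\<delta> u = 0 \<and> ?\<delta> v = 0" using zero away uv by blast
    qed (use arrows in auto)
    also have "\<dots> = p * (\<psi> b - \<psi> b') + q * (\<psi> a' - \<psi> a)"
      using ee' by (simp add: pairing_insert we we' algebra_simps)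
    finally show ?thesis .
  qed
  have "T_form \<alpha> (Some ?e) h + T_form \<alpha> (Some ?e') h = T_form \<alpha> None h"
    if h: "h \<in> insert None (Some ` arr \<alpha>)" for h
  proof -
    have "p * (weight h b - weight h b') + q * (weight h a' - weight h a) = 0"
    proof (cases "h = Some ?e \<or> h = Some ?e'")
      case True
      then show ?thesis by (elim disjE) (simp_all add: we we' algebra_simps)
    next
      case False
      have off: "v \<notin> ends f" if "h = Some f" "v \<in> {a, b, a', b'}" for f v
        using that False h arrow_cases[OF _ arrows(1), of f] arrow_cases[OF _ arrows(2), of f] by auto
      have "weight h x = weight h y"
        by (rule weight_gap[OF xyzw(1,2) h gap(1)]) (use off ab in \<open>auto simp: doubleton_eq_iff\<close>)
      then have "weight h a = weight h a'" using ab(1) by (auto simp: doubleton_eq_iff)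
      have "weight h z = weight h w"
        by (rule weight_gap[OF xyzw(3,4) h gap(2)]) (use off ab in \<open>auto simp: doubleton_eq_iff\<close>)
      then have "weight h b = weight h b'" using ab(2) by (auto simp: doubleton_eq_iff)
      with \<open>weight h a = weight h a'\<close> show ?thesis by simp
    qed
    then have "arrow_pairing (arr \<alpha>) ?\<delta> (weight h) = 0" using pair by simp
    then have "real_of_int (T_form \<alpha> (Some ?e) h) + real_of_int (T_form \<alpha> (Some ?e') h)
        = real_of_int (T_form \<alpha> None h)"
      using T_form_pairing[of "Some ?e" \<alpha> h] T_form_pairing[of "Some ?e'" \<alpha> h]
        T_form_pairing[of None \<alpha> h] arrows h
      unfolding pairing_diff pairing_add by (simp del: weight_None T_form.simps)
    then show ?thesis by linarith
  qed
  then show ?thesis using arrows ee' by (simp add: complementary_def)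
qed

lemma T_form_type1:
  assumes t: "type1 \<alpha> \<beta>" and g: "g \<in> insert None (Some ` arr \<alpha>)" and h: "h \<in> insert None (Some ` arr \<alpha>)"
  shows "T_form \<beta> g h = T_form \<alpha> g h"
  using t
proof cases
  case (1 a b)
  have ab: "a \<in> circle_arc a b" "b \<in> circle_arc a b"
    using 1 circle_arc_ends by auto
  then have new: "a \<notin> endpoints \<alpha>" "b \<notin> endpoints \<alpha>" using 1(4) by auto
  have gap: "open_circle_arc a b \<inter> endpoints \<alpha> = {}"
    using 1(4) open_circle_arc_subset[of a b] by auto
  have w: "weight k a = weight k b" if k: "k \<in> insert None (Some ` arr \<alpha>)" for k
    using new by (intro weight_gap[OF 1(1,2) k gap]) (use k in \<open>auto simp: endpoints_def\<close>)
  have "(a, b) \<notin> arr \<alpha>" "(b, a) \<notin> arr \<alpha>" using new endpoints_in by blast+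
  then have "arrow_pairing (arr \<beta>) (weight g) (weight h) = arrow_pairing (arr \<alpha>) (weight g) (weight h)"
    using 1(5) w[OF g] w[OF h] by (auto simp: pairing_insert)
  then show ?thesis using g h 1(5) by (intro T_form_eqI) auto
qed

lemma type1_removable:
  assumes "type1 \<alpha> \<beta>"
  obtains e where "arr \<beta> = insert e (arr \<alpha>)" "e \<notin> arr \<alpha>" "removable (T_matrix \<beta>) {Some e}"
  using assms
proof cases
  case (1 a b)
  have ab: "a \<in> circle_arc a b" "b \<in> circle_arc a b"
    using 1 circle_arc_ends by auto
  then have new: "a \<notin> endpoints \<alpha>" "b \<notin> endpoints \<alpha>" using 1(4) by auto
  have gap: "open_circle_arc a b \<inter> endpoints \<alpha> = {}"
    using 1(4) open_circle_arc_subset[of a b] by auto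
  have "endpoints \<beta> = {a, b} \<union> endpoints \<alpha>"
    using 1(5) by (auto simp: endpoints_def ends_def)
  then have gap': "open_circle_arc a b \<inter> endpoints \<beta> = {}"
    using gap open_circle_arc_ends by auto
  have "(a, b) \<notin> arr \<alpha>" "(b, a) \<notin> arr \<alpha>" using new endpoints_in by blast+
  moreover have "annihilating (T_matrix \<beta>) (Some (a, b))" if "(a, b) \<in> arr \<beta>"
    using free_arc_annihilating[OF that gap'] .
  moreover have "core (T_matrix \<beta>) (Some (b, a))" if "(b, a) \<in> arr \<beta>"
    using free_arc_core[OF that gap'] .
  ultimately show ?thesis using 1(5) that unfolding removable_def by blast
qed

text \<open>The contributions of the two new arrows to the pairing of old weights cancel, since an old weight
  does not distinguish \<open>a\<close> from \<open>a'\<close> or \<open>b\<close> from \<open>b'\<close>.\<close>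

lemma T_form_type2:
  assumes t: "type2 \<alpha> \<beta>" and g: "g \<in> insert None (Some ` arr \<alpha>)" and h: "h \<in> insert None (Some ` arr \<alpha>)"
  shows "T_form \<beta> g h = T_form \<alpha> g h"
  using t
proof cases
  case (1 x y z w a a' b b')
  have c: "x \<in> circle" "y \<in> circle" "z \<in> circle" "w \<in> circle" using 1(1) by auto
  have xy: "x \<in> circle_arc x y" "y \<in> circle_arc x y" "z \<in> circle_arc z w" "w \<in> circle_arc z w"
    using c circle_arc_ends by auto
  have new: "x \<notin> endpoints \<alpha>" "y \<notin> endpoints \<alpha>" "z \<notin> endpoints \<alpha>" "w \<notin> endpoints \<alpha>"
    using xy 1(7,8) by auto
  have gap: "open_circle_arc x y \<inter> endpoints \<alpha> = {}" "open_circle_arc z w \<inter> endpoints \<alpha> = {}"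
    using 1(7,8) open_circle_arc_subset[of x y] open_circle_arc_subset[of z w] by auto
  have "weight k x = weight k y" "weight k z = weight k w" if k: "k \<in> insert None (Some ` arr \<alpha>)" for k
    using new weight_gap[OF c(1,2) k gap(1)] weight_gap[OF c(3,4) k gap(2)] k by (auto simp: endpoints_def)
  then have w: "weight k a = weight k a'" "weight k b = weight k b'" if "k \<in> insert None (Some ` arr \<alpha>)" for k
    using 1(4,5) that by (metis doubleton_eq_iff)+
  have "(a, b) \<notin> arr \<alpha>" "(b', a') \<notin> arr \<alpha>" "(a, b) \<noteq> (b', a')"
    using new endpoints_in xy 1(4,5,6) by (auto simp: doubleton_eq_iff)
  moreover have "arr \<beta> = insert (a, b) (insert (b', a') (arr \<alpha>))" using 1(9) by auto
  ultimately have "arrow_pairing (arr \<beta>) (weight g) (weight h) = arrow_pairing (arr \<alpha>) (weight g) (weight h)"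
    using w[OF g] w[OF h] by (simp add: pairing_insert)
  then show ?thesis using g h 1(9) by (intro T_form_eqI) auto
qed

lemma type2_removable:
  assumes "type2 \<alpha> \<beta>"
  obtains e e' where "arr \<beta> = arr \<alpha> \<union> {e, e'}" "e \<notin> arr \<alpha>" "e' \<notin> arr \<alpha>"
    "removable (T_matrix \<beta>) {Some e, Some e'}"
  using assms
proof cases
  case (1 x y z w a a' b b')
  have xy: "x \<in> circle_arc x y" "y \<in> circle_arc x y" "z \<in> circle_arc z w" "w \<in> circle_arc z w"
    using 1 circle_arc_ends by auto
  have aa: "{a, a'} \<subseteq> circle_arc x y" "{b, b'} \<subseteq> circle_arc z w"
    unfolding 1(4,5) using xy by auto
  have new: "(a, b) \<notin> arr \<alpha>" "(b', a') \<notin> arr \<alpha>"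
    using endpoints_in[of _ _ \<alpha>] aa 1(7) by blast+
  have "endpoints \<beta> = {a, a'} \<union> {b, b'} \<union> endpoints \<alpha>"
    using 1(9) by (auto simp: endpoints_def ends_def)
  then have ep: "endpoints \<beta> = {x, y} \<union> {z, w} \<union> endpoints \<alpha>"
    using 1(4,5) by simp
  have "open_circle_arc x y \<inter> {x, y} = {}" "open_circle_arc z w \<inter> {z, w} = {}"
    using open_circle_arc_ends by auto
  moreover have "open_circle_arc x y \<inter> {z, w} = {}" "open_circle_arc z w \<inter> {x, y} = {}"
    using 1(6) xy open_circle_arc_subset[of x y] open_circle_arc_subset[of z w] by auto
  moreover have "open_circle_arc x y \<inter> endpoints \<alpha> = {}" "open_circle_arc z w \<inter> endpoints \<alpha> = {}"
    using 1(7,8) open_circle_arc_subset[of x y] open_circle_arc_subset[of z w] by auto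
  ultimately have gap: "open_circle_arc x y \<inter> endpoints \<beta> = {}" "open_circle_arc z w \<inter> endpoints \<beta> = {}"
    unfolding ep Int_Un_distrib by simp_all
  have "complementary (T_matrix \<beta>) (Some (a, b)) (Some (b', a'))"
    using 1(9) by (intro parallel_complementary[OF 1(4,5,6) gap]) auto
  then show ?thesis using that[of "(a, b)" "(b', a')"] new 1(9) unfolding removable_def by blast
qed

text \<open>Transfers the hypothesis on closed arcs to open ones.\<close>

lemma oriented_homeo_facts:
  assumes "oriented_homeo h"
  shows "inj_on h circle" "x \<in> circle \<Longrightarrow> h x \<in> circle"
    "\<lbrakk>x \<in> circle; y \<in> circle; z \<in> circle; x \<noteq> y\<rbrakk> \<Longrightarrow> h z \<in> open_circle_arc (h x) (h y) \<longleftrightarrow> z \<in> open_circle_arc x y"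
proof -
  obtain k where k: "homeomorphism circle circle h k" using assms unfolding oriented_homeo_def by blast
  then show inj: "inj_on h circle"
    by (intro inj_on_inverseI[of _ k]) (simp add: homeomorphism_def)
  show im: "h x \<in> circle" if "x \<in> circle" for x using k that by (auto simp: homeomorphism_def)
  show "h z \<in> open_circle_arc (h x) (h y) \<longleftrightarrow> z \<in> open_circle_arc x y"
    if c: "x \<in> circle" "y \<in> circle" "z \<in> circle" "x \<noteq> y"
  proof (cases "z = x \<or> z = y")
    case True
    then show ?thesis using open_circle_arc_ends by metis
  next
    case False
    have ne: "h z \<noteq> h x" "h z \<noteq> h y" "h x \<noteq> h y"
      using inj c False by (auto dest: inj_onD)
    have sub: "circle_arc x y \<subseteq> circle" by (auto simp: circle_arc_def)
    have "h z \<in> open_circle_arc (h x) (h y) \<longleftrightarrow> h z \<in> circle_arc (h x) (h y)"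
      using circle_arc_eq[OF im[OF c(1)] im[OF c(2)]] ne by auto
    also have "circle_arc (h x) (h y) = h ` circle_arc x y"
      using assms c by (simp add: oriented_homeo_def)
    also have "h z \<in> h ` circle_arc x y \<longleftrightarrow> z \<in> circle_arc x y"
      using inj sub c(3) by (simp add: inj_on_image_mem_iff)
    also have "\<dots> \<longleftrightarrow> z \<in> open_circle_arc x y"
      using circle_arc_eq[OF c(1,2,4)] False by auto
    finally show ?thesis .
  qed
qed

lemma T_form_homeo:
  assumes hom: "oriented_homeo \<eta>" and arr: "arr \<beta> = map_prod \<eta> \<eta> ` arr \<alpha>"
    and g: "g \<in> insert None (Some ` arr \<alpha>)" and h: "h \<in> insert None (Some ` arr \<alpha>)"
  shows "T_form \<beta> (map_option (map_prod \<eta> \<eta>) g) (map_option (map_prod \<eta> \<eta>) h) = T_form \<alpha> g h"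
    (is "T_form \<beta> (?m g) (?m h) = _")
proof -
  note H = oriented_homeo_facts[OF hom]
  have w: "weight (?m k) (\<eta> z) = weight k z" if k: "k \<in> insert None (Some ` arr \<alpha>)" and z: "z \<in> circle" for k z
  proof (cases k)
    case (Some e)
    obtain u v where e: "e = (u, v)" by fastforce
    have c: "u \<in> circle" "v \<in> circle" "u \<noteq> v" using arr_circle[of u v \<alpha>] k Some e by auto
    have "\<eta> z = \<eta> u \<longleftrightarrow> z = u" "\<eta> z = \<eta> v \<longleftrightarrow> z = v" using H(1) c z by (auto dest: inj_onD)
    then show ?thesis using H(3)[OF c(1,2) z c(3)] by (simp add: Some e weight_Some)
  qed simp
  have "inj_on (map_prod \<eta> \<eta>) (circle \<times> circle)"
    using H(1) by (auto simp: inj_on_def)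
  moreover have "arr \<alpha> \<subseteq> circle \<times> circle" using arr_circle by fastforce
  ultimately have "inj_on (map_prod \<eta> \<eta>) (arr \<alpha>)" by (rule inj_on_subset)
  then have "arrow_pairing (arr \<beta>) (weight (?m g)) (weight (?m h))
    = arrow_pairing (arr \<alpha>) (weight (?m g) \<circ> \<eta>) (weight (?m h) \<circ> \<eta>)"
    unfolding arr by (rule pairing_image)
  also have "\<dots> = arrow_pairing (arr \<alpha>) (weight g) (weight h)"
    using w[OF g] w[OF h] arr_circle by (intro pairing_cong) auto
  finally show ?thesis using g h arr by (intro T_form_eqI) auto
qed

section \<open>Moves of type 3\<close>

definition before :: "vstring \<Rightarrow> complex \<Rightarrow> complex \<Rightarrow> bool" where
  "before \<alpha> x y \<longleftrightarrow> x \<in> endpoints \<alpha> \<and> y \<in> endpoints \<alpha> \<and> x \<noteq> y \<and>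
     open_circle_arc x y \<inter> endpoints \<alpha> = {}"

text \<open>All four facts say that \<open>y\<close> follows \<open>x\<close> immediately, as seen from a third point \<open>v\<close>.\<close>

lemma before_order:
  assumes "before \<alpha> x y" "v \<in> endpoints \<alpha>" "v \<noteq> x" "v \<noteq> y"
  shows "y \<in> open_circle_arc x v" "x \<notin> open_circle_arc y v"
    "x \<in> open_circle_arc v y" "y \<notin> open_circle_arc v x"
proof -
  have c: "x \<in> circle" "y \<in> circle" "v \<in> circle"
    using assms endpoints_circle by (auto simp: before_def)
  have i: "Arg2pi x \<noteq> Arg2pi y" "Arg2pi x \<noteq> Arg2pi v" "Arg2pi y \<noteq> Arg2pi v"
    using assms c Arg2pi_circle_inj by (auto simp: before_def)
  have "v \<notin> open_circle_arc x y" using assms by (auto simp: before_def)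
  then show "y \<in> open_circle_arc x v" "x \<notin> open_circle_arc y v"
    "x \<in> open_circle_arc v y" "y \<notin> open_circle_arc v x"
    using i unfolding in_open_circle_arc_iff[OF c(1,2,3)] in_open_circle_arc_iff[OF c(1,3,2)]
      in_open_circle_arc_iff[OF c(2,3,1)] in_open_circle_arc_iff[OF c(3,2,1)]
      in_open_circle_arc_iff[OF c(3,1,2)]
    by (auto split: if_splits)
qed

lemma before_asym:
  assumes "before \<alpha> x y" "v \<in> endpoints \<alpha>" "v \<noteq> x" "v \<noteq> y"
  shows "\<not> before \<alpha> y x"
  using before_order(1)[OF assms] before_order(2)[of \<alpha> y x v] assms by auto

lemma before_move:
  assumes "before \<alpha> x y \<or> before \<alpha> y x" "v \<in> endpoints \<alpha>" "z \<in> endpoints \<alpha>" "distinct [x, y, v, z]"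
  shows "z \<in> open_circle_arc x v \<longleftrightarrow> z \<in> open_circle_arc y v"
    "z \<in> open_circle_arc v x \<longleftrightarrow> z \<in> open_circle_arc v y"
proof -
  have c: "x \<in> circle" "y \<in> circle" "v \<in> circle" "z \<in> circle"
    using assms endpoints_circle by (auto simp: before_def)
  have i: "Arg2pi x \<noteq> Arg2pi y" "Arg2pi x \<noteq> Arg2pi v" "Arg2pi y \<noteq> Arg2pi v"
    "Arg2pi x \<noteq> Arg2pi z" "Arg2pi y \<noteq> Arg2pi z" "Arg2pi v \<noteq> Arg2pi z"
    using assms(4) c Arg2pi_circle_inj by auto
  have "v \<notin> open_circle_arc x y \<and> z \<notin> open_circle_arc x y \<or>
    v \<notin> open_circle_arc y x \<and> z \<notin> open_circle_arc y x"
    using assms(1-3) by (auto simp: before_def)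
  then show "z \<in> open_circle_arc x v \<longleftrightarrow> z \<in> open_circle_arc y v"
    "z \<in> open_circle_arc v x \<longleftrightarrow> z \<in> open_circle_arc v y"
    using i unfolding in_open_circle_arc_iff[OF c(1,2,3)] in_open_circle_arc_iff[OF c(2,1,3)]
      in_open_circle_arc_iff[OF c(1,2,4)] in_open_circle_arc_iff[OF c(2,1,4)]
      in_open_circle_arc_iff[OF c(1,3,4)] in_open_circle_arc_iff[OF c(3,1,4)]
      in_open_circle_arc_iff[OF c(2,3,4)] in_open_circle_arc_iff[OF c(3,2,4)]
    by (smt (verit))+
qed

lemma before_same_side:
  assumes "before \<alpha> x y \<or> before \<alpha> y x" "u \<in> endpoints \<alpha>" "v \<in> endpoints \<alpha>" "{u, v} \<inter> {x, y} = {}"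
  shows "x \<in> open_circle_arc u v \<longleftrightarrow> y \<in> open_circle_arc u v"
proof -
  have c: "{x, y, u, v} \<subseteq> circle" using assms endpoints_circle by (auto simp: before_def)
  then have c': "{y, x, u, v} \<subseteq> circle" by auto
  have d: "{u, v} \<inter> {y, x} = {}" using assms(4) by auto
  have "open_circle_arc x y \<inter> {u, v} = {} \<or> open_circle_arc y x \<inter> {u, v} = {}"
    using assms(1-3) by (auto simp: before_def)
  then show ?thesis using gap_same_side[OF c assms(4)] gap_same_side[OF c' d] by blast
qed

text \<open>A neighbour \<open>u'\<close> of an end of an arrow lies inside the arc of the arrow or outside of it, depending
  on the side on which it is; the two ends behave oppositely.\<close>

lemma weight_behind_end:
  assumes u: "before \<alpha> u u' \<or> before \<alpha> u' u" and v: "before \<alpha> v v' \<or> before \<alpha> v' v"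
    and d: "distinct [u, u', v, v']"
  shows "weight (Some (u, v)) u' = (if before \<alpha> u u' then 1 else 0)"
    "weight (Some (u, v)) v' = (if before \<alpha> v v' then 0 else 1)"
proof -
  have e: "u \<in> endpoints \<alpha>" "u' \<in> endpoints \<alpha>" "v \<in> endpoints \<alpha>" "v' \<in> endpoints \<alpha>"
    using u v by (auto simp: before_def)
  show "weight (Some (u, v)) u' = (if before \<alpha> u u' then 1 else 0)"
    using u d before_order(1)[of \<alpha> u u' v] before_order(2)[of \<alpha> u' u v] e by (auto simp: weight_Some)
  show "weight (Some (u, v)) v' = (if before \<alpha> v v' then 0 else 1)"
    using v d before_order(3)[of \<alpha> v' v u] before_order(4)[of \<alpha> v v' u] e by (auto simp: weight_Some)
qed

text \<open>Away from the ends, pushing both ends of an arrow to neighbouring points does not change its weight.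
  The variant with \<open>z'\<close> moves the argument to a neighbour as well, as required at the third pair
  of points of a triangle.\<close>

lemma weight_shifted_arrow:
  assumes u: "before \<alpha> u u' \<or> before \<alpha> u' u" and v: "before \<alpha> v v' \<or> before \<alpha> v' v"
    and d: "distinct [u, u', v, v']" "z \<in> endpoints \<alpha>" "z \<notin> {u, u', v, v'}"
    and z': "z' = z \<or> before \<alpha> z z' \<or> before \<alpha> z' z" "z' \<notin> {u, u', v, v'}"
  shows "weight (Some (u', v')) z' = weight (Some (u, v)) z"
proof -
  have e: "u \<in> endpoints \<alpha>" "u' \<in> endpoints \<alpha>" "v \<in> endpoints \<alpha>" "v' \<in> endpoints \<alpha>"
    using u v by (auto simp: before_def)
  have "z \<in> open_circle_arc u v \<longleftrightarrow> z \<in> open_circle_arc u' v"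
    using d by (intro before_move(1)[OF u e(3)]) auto
  also have "\<dots> \<longleftrightarrow> z \<in> open_circle_arc u' v'"
    using d by (intro before_move(2)[OF v e(2)]) auto
  also have "\<dots> \<longleftrightarrow> z' \<in> open_circle_arc u' v'"
    using z' d before_same_side[of \<alpha> z z' u' v'] e by auto
  finally show ?thesis using d z' by (simp add: weight_Some)
qed

lemma pairing_split:
  assumes "finite A" "S \<subseteq> A"
  shows "arrow_pairing A \<phi> \<psi> = arrow_pairing (A - S) \<phi> \<psi> + arrow_pairing S \<phi> \<psi>"
  unfolding arrow_pairing_def using assms by (intro sum.subset_diff) auto

text \<open>The involution that exchanges \<open>a\<close> with \<open>p\<close>, \<open>b\<close> with \<open>q\<close> and \<open>c\<close> with \<open>r\<close>. Both kinds of type 3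
  moves consist in applying it to all arrows.\<close>

definition swap_ends :: "complex \<Rightarrow> complex \<Rightarrow> complex \<Rightarrow> complex \<Rightarrow> complex \<Rightarrow> complex \<Rightarrow> complex \<Rightarrow> complex" where
  "swap_ends a p b q c r z = (if z = a then p else if z = p then a else if z = b then q
     else if z = q then b else if z = c then r else if z = r then c else z)"

text \<open>Transporting back by \<open>\<tau>\<close>, the same arrows are paired with the new weights \<open>w k z\<close> instead of the old
  ones. New and old weights differ only at the six points of the triangle and only for its three
  arrows. So all other arrows contribute the same as before, and the contribution of the three
  arrows of \<open>S\<close> is compared by means of the tables of the weights at the six points. In these tables
  the value of an arrow of the triangle at the pair of points that it does not meet, and the
  values of all other elements, remain unknowns that drop out.\<close>

lemma T_form_swap:
  assumes d: "distinct [a, p, b, q, c, r]"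
    and ap: "before \<alpha> a p" and bq: "before \<alpha> b q" and cr: "before \<alpha> c r"
    and \<tau>: "\<tau> = swap_ends a p b q c r"
    and S: "S \<subseteq> arr \<alpha>" "S = {(p, b), (q, c), (r, a)} \<or> S = {(a, b), (p, c), (q, r)}"
    and \<beta>: "arr \<beta> = map_prod \<tau> \<tau> ` arr \<alpha>"
    and g: "g \<in> insert None (Some ` arr \<alpha>)" and h: "h \<in> insert None (Some ` arr \<alpha>)"
  shows "T_form \<beta> (map_option (map_prod \<tau> \<tau>) g) (map_option (map_prod \<tau> \<tau>) h) = T_form \<alpha> g h"
proof -
  let ?m = "map_option (map_prod \<tau> \<tau>)"
  define w where "w k z = weight (?m k) (\<tau> z)" for k z
  have e: "{a, p, b, q, c, r} \<subseteq> endpoints \<alpha>" using ap bq cr by (auto simp: before_def)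
  have nb: "\<not> before \<alpha> p a" "\<not> before \<alpha> q b" "\<not> before \<alpha> r c"
    using before_asym[OF ap, of b] before_asym[OF bq, of a] before_asym[OF cr, of a] d e by auto
  have \<tau>v [simp]: "\<tau> a = p" "\<tau> p = a" "\<tau> b = q" "\<tau> q = b" "\<tau> c = r" "\<tau> r = c"
    using d by (auto simp: \<tau> swap_ends_def)
  have \<tau>o: "\<tau> z = z" if "z \<notin> {a, p, b, q, c, r}" for z
    using that by (simp add: \<tau> swap_ends_def)
  have \<tau>\<tau>: "\<tau> (\<tau> z) = z" for z using d by (auto simp: \<tau> swap_ends_def)
  then have "inj \<tau>" by (metis injI)
  then have inj: "inj_on (map_prod \<tau> \<tau>) (arr \<alpha>)" by (auto simp: inj_on_def dest: injD)
  have away: "x \<notin> {a, p, b, q, c, r} \<and> y \<notin> {a, p, b, q, c, r}" if xy: "(x, y) \<in> arr \<alpha> - S" for x y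
  proof -
    have "\<exists>f\<in>S. v \<in> ends f" if "v \<in> {a, p, b, q, c, r}" for v
      using S(2) that by (auto simp: ends_def)
    moreover have "\<not> (\<exists>f\<in>S. v \<in> ends f)" if "v = x \<or> v = y" for v
      using arrow_cases[of _ \<alpha> x y] S(1) xy that by blast
    ultimately show ?thesis by blast
  qed
  have end_cases: "z \<in> {a, p, b, q, c, r} \<or> \<tau> z = z" for z using \<tau>o by blast
  have near: "\<tau> z = z \<or> before \<alpha> z (\<tau> z) \<or> before \<alpha> (\<tau> z) z" for z
    using end_cases[of z] ap bq cr by auto
  \<comment> \<open>Elements other than the three arrows do not separate neighbouring points.\<close>
  have plain: "w k z = weight k z"
    if k: "k \<in> insert None (Some ` (arr \<alpha> - S))" and z: "z \<in> endpoints \<alpha>" for k z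
  proof (cases k)
    case (Some f)
    obtain x y where f: "f = (x, y)" by fastforce
    have xy: "(x, y) \<in> arr \<alpha> - S" using k Some f by auto
    note a = away[OF xy]
    then have "?m k = k" using \<tau>o by (simp add: Some f)
    moreover have "weight (Some (x, y)) (\<tau> z) = weight (Some (x, y)) z"
    proof (cases "\<tau> z = z")
      case False
      then have "z \<in> {a, p, b, q, c, r}" using \<tau>o by blast
      moreover from this have "\<tau> z \<in> {a, p, b, q, c, r}" by auto
      ultimately have "x \<noteq> z" "y \<noteq> z" "x \<noteq> \<tau> z" "y \<noteq> \<tau> z" using a by metis+
      moreover have "x \<in> endpoints \<alpha>" "y \<in> endpoints \<alpha>" using xy endpoints_in by blast+
      ultimately have "z \<in> open_circle_arc x y \<longleftrightarrow> \<tau> z \<in> open_circle_arc x y"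
        using near[of z] False by (intro before_same_side) auto
      then show ?thesis using \<open>x \<noteq> z\<close> \<open>y \<noteq> z\<close> \<open>x \<noteq> \<tau> z\<close> \<open>y \<noteq> \<tau> z\<close> by (simp add: weight_Some)
    qed simp
    ultimately show ?thesis by (simp add: w_def Some f)
  qed (simp add: w_def)
  have plain_pair: "weight k a = weight k p" "weight k b = weight k q" "weight k c = weight k r"
    if k: "k \<in> insert None (Some ` (arr \<alpha> - S))" for k
  proof -
    have k': "k \<in> insert None (Some ` arr \<alpha>)" using k by auto
    have off: "v \<notin> ends f" if "k = Some f" "v \<in> {a, p, b, q, c, r}" for f v
      using away[of "fst f" "snd f"] k that by (auto simp: ends_def)
    show "weight k a = weight k p" "weight k b = weight k q" "weight k c = weight k r"
      using ap bq cr endpoints_circle off by (intro weight_gap[OF _ _ k']; auto simp: before_def)+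
  qed
  have outside: "w k x = weight k x \<and> w k y = weight k y"
    if k: "k \<in> insert None (Some ` arr \<alpha>)" and xy: "(x, y) \<in> arr \<alpha> - S" for k x y
  proof (cases "k \<in> insert None (Some ` (arr \<alpha> - S))")
    case True
    then show ?thesis using plain xy endpoints_in by blast
  next
    case False
    then obtain f where f: "k = Some f" "f \<in> S" using k by blast
    have "x \<in> endpoints \<alpha>" "y \<in> endpoints \<alpha>" using xy endpoints_in by blast+
    then show ?thesis
      unfolding w_def f(1) using away[OF xy] f(2) S(2) \<tau>o[of x] \<tau>o[of y] d ap bq cr
      by (auto intro!: weight_shifted_arrow)
  qed
  let ?six = "{a, p, b, q, c, r}"
  \<comment> \<open>The arrow from \<open>u\<close> to \<open>v\<close> at the two pairs that it meets, and then at the third one.\<close>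
  have special: "weight (Some (u, v)) u = 1 / 2 \<and> weight (Some (u, v)) v = 1 / 2 \<and>
      weight (Some (u, v)) (\<tau> u) = (if before \<alpha> u (\<tau> u) then 1 else 0) \<and>
      weight (Some (u, v)) (\<tau> v) = (if before \<alpha> v (\<tau> v) then 0 else 1) \<and>
      w (Some (u, v)) u = 1 / 2 \<and> w (Some (u, v)) v = 1 / 2 \<and>
      w (Some (u, v)) (\<tau> u) = (if before \<alpha> (\<tau> u) u then 1 else 0) \<and>
      w (Some (u, v)) (\<tau> v) = (if before \<alpha> (\<tau> v) v then 0 else 1)"
    and third: "weight (Some (u, v)) (\<tau> s) = weight (Some (u, v)) s \<and> w (Some (u, v)) s = weight (Some (u, v)) s"
    if uv: "u \<in> ?six" "v \<in> ?six" "v \<noteq> u" "v \<noteq> \<tau> u"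
      and s: "s \<in> ?six" "s \<notin> {u, \<tau> u, v, \<tau> v}" for u v s
  proof -
    have b: "before \<alpha> z (\<tau> z) \<or> before \<alpha> (\<tau> z) z" if "z \<in> ?six" for z
      using that ap bq cr by auto
    have ne: "\<tau> z \<noteq> z" if "z \<in> ?six" for z using that d by auto
    have dist: "distinct [u, \<tau> u, v, \<tau> v]"
    proof -
      have "\<tau> u \<noteq> \<tau> v" "u \<noteq> \<tau> v" using uv(3,4) \<tau>\<tau>[of u] \<tau>\<tau>[of v] by auto
      then show ?thesis using uv(3,4) ne[OF uv(1)] ne[OF uv(2)] by auto
    qed
    have b': "before \<alpha> (\<tau> z) z \<or> before \<alpha> z (\<tau> z)" if "z \<in> ?six" for z
      using b[OF that] by blast
    have dist': "distinct [\<tau> u, u, \<tau> v, v]" using dist by auto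
    show "weight (Some (u, v)) u = 1 / 2 \<and> weight (Some (u, v)) v = 1 / 2 \<and>
      weight (Some (u, v)) (\<tau> u) = (if before \<alpha> u (\<tau> u) then 1 else 0) \<and>
      weight (Some (u, v)) (\<tau> v) = (if before \<alpha> v (\<tau> v) then 0 else 1) \<and>
      w (Some (u, v)) u = 1 / 2 \<and> w (Some (u, v)) v = 1 / 2 \<and>
      w (Some (u, v)) (\<tau> u) = (if before \<alpha> (\<tau> u) u then 1 else 0) \<and>
      w (Some (u, v)) (\<tau> v) = (if before \<alpha> (\<tau> v) v then 0 else 1)"
      using weight_behind_end[OF b[OF uv(1)] b[OF uv(2)] dist]
        weight_behind_end[OF b'[OF uv(1)] b'[OF uv(2)] dist']
      by (simp add: w_def \<tau>\<tau> weight_Some)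
    have \<tau>s: "\<tau> s \<notin> {u, \<tau> u, v, \<tau> v}" using s(2) \<tau>\<tau>[of s] \<tau>\<tau>[of u] \<tau>\<tau>[of v] by auto
    have se: "s \<in> endpoints \<alpha>" "u \<in> endpoints \<alpha>" "v \<in> endpoints \<alpha>" using s(1) uv(1,2) e by auto
    have "s \<in> open_circle_arc u v \<longleftrightarrow> \<tau> s \<in> open_circle_arc u v"
      using s \<tau>s by (intro before_same_side[OF b[OF s(1)] se(2,3)]) auto
    then have "weight (Some (u, v)) (\<tau> s) = weight (Some (u, v)) s"
      using s \<tau>s by (simp add: weight_Some)
    moreover have "w (Some (u, v)) s = weight (Some (u, v)) s"
      using weight_shifted_arrow[OF b[OF uv(1)] b[OF uv(2)] dist se(1) s(2) _ \<tau>s] near[of s]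
      by (simp add: w_def)
    ultimately show "weight (Some (u, v)) (\<tau> s) = weight (Some (u, v)) s \<and> w (Some (u, v)) s = weight (Some (u, v)) s" ..
  qed
  have pl: "w k a = weight k a" "w k b = weight k b" "w k c = weight k c"
     "w k p = weight k a" "w k q = weight k b" "w k r = weight k c"
     "weight k p = weight k a" "weight k q = weight k b" "weight k r = weight k c"
    if "k \<in> insert None (Some ` (arr \<alpha> - S))" for k
    using plain[OF that] plain_pair[OF that] e by auto
  have inside: "arrow_pairing S (w g) (w h) = arrow_pairing S (weight g) (weight h)"
    using S(2)
  proof
    assume SA: "S = {(p, b), (q, c), (r, a)}"
    have exp: "arrow_pairing S \<phi> \<psi> = (\<phi> p * \<psi> b - \<psi> p * \<phi> b) + ((\<phi> q * \<psi> c - \<psi> q * \<phi> c) + (\<phi> r * \<psi> a - \<psi> r * \<phi> a))" for \<phi> \<psi>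
      using d unfolding SA by (simp add: pairing_insert)
    consider (g0) "g \<in> insert None (Some ` (arr \<alpha> - S))" | (g1) "g = Some (p, b)" | (g2) "g = Some (q, c)" | (g3) "g = Some (r, a)"
      using g SA by blast
    note gc = this
    consider (h0) "h \<in> insert None (Some ` (arr \<alpha> - S))" | (h1) "h = Some (p, b)" | (h2) "h = Some (q, c)" | (h3) "h = Some (r, a)"
      using h SA by blast
    note hc = this
    note t1 = special[of p b c] third[of p b c] third[of p b r]
    note t2 = special[of q c a] third[of q c a] third[of q c p]
    note t3 = special[of r a b] third[of r a b] third[of r a q]
    have t1: "weight (Some (p, b)) p = 1 / 2" "weight (Some (p, b)) b = 1 / 2" "weight (Some (p, b)) a = 0"
      "weight (Some (p, b)) q = 0" "w (Some (p, b)) p = 1 / 2" "w (Some (p, b)) b = 1 / 2" "w (Some (p, b)) a = 1"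
      "w (Some (p, b)) q = 1" "weight (Some (p, b)) r = weight (Some (p, b)) c"
      "w (Some (p, b)) r = weight (Some (p, b)) c" "w (Some (p, b)) c = weight (Some (p, b)) c"
      using t1 d ap bq cr nb by auto
    have t2: "weight (Some (q, c)) q = 1 / 2" "weight (Some (q, c)) c = 1 / 2" "weight (Some (q, c)) b = 0"
      "weight (Some (q, c)) r = 0" "w (Some (q, c)) q = 1 / 2" "w (Some (q, c)) c = 1 / 2" "w (Some (q, c)) b = 1"
      "w (Some (q, c)) r = 1" "weight (Some (q, c)) p = weight (Some (q, c)) a"
      "w (Some (q, c)) p = weight (Some (q, c)) a" "w (Some (q, c)) a = weight (Some (q, c)) a"
      using t2 d ap bq cr nb by auto
    have t3: "weight (Some (r, a)) r = 1 / 2" "weight (Some (r, a)) a = 1 / 2" "weight (Some (r, a)) c = 0"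
      "weight (Some (r, a)) p = 0" "w (Some (r, a)) r = 1 / 2" "w (Some (r, a)) a = 1 / 2" "w (Some (r, a)) c = 1"
      "w (Some (r, a)) p = 1" "weight (Some (r, a)) q = weight (Some (r, a)) b"
      "w (Some (r, a)) q = weight (Some (r, a)) b" "w (Some (r, a)) b = weight (Some (r, a)) b"
      using t3 d ap bq cr nb by auto
    show ?thesis
      unfolding exp by (rule gc; rule hc; simp add: t1 t2 t3 pl algebra_simps)
  next
    assume SB: "S = {(a, b), (p, c), (q, r)}"
    have exp: "arrow_pairing S \<phi> \<psi> = (\<phi> a * \<psi> b - \<psi> a * \<phi> b) + ((\<phi> p * \<psi> c - \<psi> p * \<phi> c) + (\<phi> q * \<psi> r - \<psi> q * \<phi> r))" for \<phi> \<psi>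
      using d unfolding SB by (simp add: pairing_insert)
    consider (g0) "g \<in> insert None (Some ` (arr \<alpha> - S))" | (g1) "g = Some (a, b)" | (g2) "g = Some (p, c)" | (g3) "g = Some (q, r)"
      using g SB by blast
    note gc = this
    consider (h0) "h \<in> insert None (Some ` (arr \<alpha> - S))" | (h1) "h = Some (a, b)" | (h2) "h = Some (p, c)" | (h3) "h = Some (q, r)"
      using h SB by blast
    note hc = this
    note t1 = special[of a b c] third[of a b c] third[of a b r]
    note t2 = special[of p c b] third[of p c b] third[of p c q]
    note t3 = special[of q r a] third[of q r a] third[of q r p]
    have t1: "weight (Some (a, b)) a = 1 / 2" "weight (Some (a, b)) b = 1 / 2" "weight (Some (a, b)) p = 1"
      "weight (Some (a, b)) q = 0" "w (Some (a, b)) a = 1 / 2" "w (Some (a, b)) b = 1 / 2" "w (Some (a, b)) p = 0"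
      "w (Some (a, b)) q = 1" "weight (Some (a, b)) r = weight (Some (a, b)) c"
      "w (Some (a, b)) r = weight (Some (a, b)) c" "w (Some (a, b)) c = weight (Some (a, b)) c"
      using t1 d ap bq cr nb by auto
    have t2: "weight (Some (p, c)) p = 1 / 2" "weight (Some (p, c)) c = 1 / 2" "weight (Some (p, c)) a = 0"
      "weight (Some (p, c)) r = 0" "w (Some (p, c)) p = 1 / 2" "w (Some (p, c)) c = 1 / 2" "w (Some (p, c)) a = 1"
      "w (Some (p, c)) r = 1" "weight (Some (p, c)) q = weight (Some (p, c)) b"
      "w (Some (p, c)) q = weight (Some (p, c)) b" "w (Some (p, c)) b = weight (Some (p, c)) b"
      using t2 d ap bq cr nb by auto
    have t3: "weight (Some (q, r)) q = 1 / 2" "weight (Some (q, r)) r = 1 / 2" "weight (Some (q, r)) b = 0"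
      "weight (Some (q, r)) c = 1" "w (Some (q, r)) q = 1 / 2" "w (Some (q, r)) r = 1 / 2" "w (Some (q, r)) b = 1"
      "w (Some (q, r)) c = 0" "weight (Some (q, r)) p = weight (Some (q, r)) a"
      "w (Some (q, r)) p = weight (Some (q, r)) a" "w (Some (q, r)) a = weight (Some (q, r)) a"
      using t3 d ap bq cr nb by auto
    show ?thesis
      unfolding exp by (rule gc; rule hc; simp add: t1 t2 t3 pl algebra_simps)
  qed
  have "arrow_pairing (arr \<beta>) (weight (?m g)) (weight (?m h)) = arrow_pairing (arr \<alpha>) (w g) (w h)"
    unfolding \<beta> pairing_image[OF inj] by (intro pairing_cong) (simp add: w_def)
  also have "\<dots> = arrow_pairing (arr \<alpha> - S) (w g) (w h) + arrow_pairing S (w g) (w h)"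
    using S(1) by (intro pairing_split) auto
  also have "arrow_pairing (arr \<alpha> - S) (w g) (w h) = arrow_pairing (arr \<alpha> - S) (weight g) (weight h)"
    using outside[OF g] outside[OF h] by (intro pairing_cong) blast
  also have "\<dots> + arrow_pairing S (w g) (w h) = arrow_pairing (arr \<alpha>) (weight g) (weight h)"
    unfolding inside using S(1) by (intro pairing_split[symmetric]) auto
  finally show ?thesis
    using g h \<beta> by (intro T_form_eqI) auto
qed


text \<open>Both kinds of moves act by one permutation of the points, so that they are treated like a
  homeomorphism in what follows. The six points are distinct: the definition of the move leaves
  open that one of the short arcs degenerates to a point, but then two arrows would share an end.\<close>

lemma type3_swap:
  assumes "type3 \<alpha> R \<beta>"
  obtains \<tau> where "arr \<beta> = map_prod \<tau> \<tau> ` arr \<alpha>" "inj \<tau>"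
    "\<forall>(e, e')\<in>R. e' = map_prod \<tau> \<tau> e" "\<forall>e\<in>arr \<alpha> - fst ` R. map_prod \<tau> \<tau> e = e"
    "\<forall>g\<in>insert None (Some ` arr \<alpha>). \<forall>h\<in>insert None (Some ` arr \<alpha>).
      T_form \<beta> (map_option (map_prod \<tau> \<tau>) g) (map_option (map_prod \<tau> \<tau>) h) = T_form \<alpha> g h"
proof -
  note R = type3_facts[OF assms]
  obtain a p b q c r where free: "free_arcs \<alpha> a p b q c r"
    and RS: "R = {((p, b), (a, q)), ((q, c), (b, r)), ((r, a), (c, p))} \<or>
      R = {((a, b), (p, q)), ((p, c), (a, r)), ((q, r), (b, c))}"
    using assms by cases auto
  define S where "S = fst ` R"
  have S: "S \<subseteq> arr \<alpha>" "S = {(p, b), (q, c), (r, a)} \<or> S = {(a, b), (p, c), (q, r)}"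
  proof -
    show "S \<subseteq> arr \<alpha>" using R(4) by (simp add: S_def)
    show "S = {(p, b), (q, c), (r, a)} \<or> S = {(a, b), (p, c), (q, r)}"
      using RS unfolding S_def by (elim disjE) simp_all
  qed
  define \<tau> where "\<tau> = swap_ends a p b q c r"
  have e: "{a, p, b, q, c, r} \<subseteq> endpoints \<alpha>"
    using S endpoints_in[of _ _ \<alpha>] by blast
  then have "{a, p, b, q, c, r} \<subseteq> circle" using endpoints_circle by blast
  then have "{a, p} \<subseteq> circle_arc a p" "{b, q} \<subseteq> circle_arc b q" "{c, r} \<subseteq> circle_arc c r"
    using circle_arc_ends by auto
  then have "{a, p} \<inter> {b, q} = {}" "{a, p} \<inter> {c, r} = {}" "{b, q} \<inter> {c, r} = {}"
    using free unfolding free_arcs_def by (metis Int_mono subset_empty)+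
  then have ne: "a \<noteq> b" "a \<noteq> q" "p \<noteq> b" "p \<noteq> q" "a \<noteq> c" "a \<noteq> r" "p \<noteq> c" "p \<noteq> r"
    "b \<noteq> c" "b \<noteq> r" "q \<noteq> c" "q \<noteq> r" by auto
  have uniq: "f = f'" if "f \<in> S" "f' \<in> S" "v \<in> ends f" "v \<in> ends f'" for f f' v
    using arr_disjoint that S(1) by blast
  have "a \<noteq> p \<and> b \<noteq> q \<and> c \<noteq> r"
    using S(2)
  proof
    assume "S = {(p, b), (q, c), (r, a)}"
    then show ?thesis
      using uniq[of "(p, b)" "(r, a)" a] uniq[of "(p, b)" "(q, c)" b] uniq[of "(q, c)" "(r, a)" c] ne
      by (auto simp: ends_def)
  next
    assume "S = {(a, b), (p, c), (q, r)}"
    then show ?thesis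
      using uniq[of "(a, b)" "(p, c)" a] uniq[of "(a, b)" "(q, r)" b] uniq[of "(p, c)" "(q, r)" c] ne
      by (auto simp: ends_def)
  qed
  with ne have d: "distinct [a, p, b, q, c, r]" by auto
  then have before: "before \<alpha> a p" "before \<alpha> b q" "before \<alpha> c r"
    using free e by (auto simp: before_def free_arcs_def)
  have \<tau>v: "\<tau> a = p" "\<tau> p = a" "\<tau> b = q" "\<tau> q = b" "\<tau> c = r" "\<tau> r = c"
    using d by (auto simp: \<tau>_def swap_ends_def)
  have "\<tau> (\<tau> z) = z" for z using d by (auto simp: \<tau>_def swap_ends_def)
  then have inj: "inj \<tau>" by (metis injI)
  have move: "e' = map_prod \<tau> \<tau> e" if "(e, e') \<in> R" for e e'
    using that RS \<tau>v by auto
  have still: "map_prod \<tau> \<tau> e = e" if "e \<in> arr \<alpha> - fst ` R" for e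
  proof -
    obtain x y where xy: "e = (x, y)" by fastforce
    have "\<exists>f\<in>S. v \<in> ends f" if "v \<in> {a, p, b, q, c, r}" for v
      using S(2) that by (auto simp: ends_def)
    moreover have "\<not> (\<exists>f\<in>S. v \<in> ends f)" if "v = x \<or> v = y" for v
      using arrow_cases[of _ \<alpha> x y] S(1) xy that \<open>e \<in> arr \<alpha> - fst ` R\<close> unfolding S_def by blast
    ultimately have "x \<notin> {a, p, b, q, c, r}" "y \<notin> {a, p, b, q, c, r}" by blast+
    then show ?thesis by (simp add: xy \<tau>_def swap_ends_def)
  qed
  have "snd ` R = map_prod \<tau> \<tau> ` fst ` R" using move by force
  moreover have "arr \<alpha> - fst ` R = map_prod \<tau> \<tau> ` (arr \<alpha> - fst ` R)" using still by force
  ultimately have "arr \<beta> = map_prod \<tau> \<tau> ` ((arr \<alpha> - fst ` R) \<union> fst ` R)"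
    unfolding R(5) image_Un by simp
  then have \<beta>: "arr \<beta> = map_prod \<tau> \<tau> ` arr \<alpha>" using R(4) by (simp add: Un_absorb2)
  show ?thesis
    using that[OF \<beta> inj] move still T_form_swap[OF d before \<tau>_def S \<beta>] by blast
qed

section \<open>Signed singular strings\<close>

text \<open>The marked row is chosen so that exchanging the distinguished arrow for a complementary one while
  reversing the sign does not change it.\<close>

definition mark_row :: "vstring \<Rightarrow> arrow \<Rightarrow> sign \<Rightarrow> arrow option \<Rightarrow> int" where
  "mark_row \<alpha> d \<epsilon> h = (case \<epsilon> of Plus \<Rightarrow> T_form \<alpha> (Some d) h
     | Minus \<Rightarrow> T_form \<alpha> None h - T_form \<alpha> (Some d) h)"

definition sstring_reduces :: "arrow option bmatrix \<Rightarrow> (arrow option \<Rightarrow> int) \<Rightarrow> sstring \<Rightarrow> bool" where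
  "sstring_reduces P \<sigma> X \<longleftrightarrow>
     (case Rep_sstring X of (\<alpha>, d, \<epsilon>) \<Rightarrow> reduces P \<sigma> (T_matrix \<alpha>) (mark_row \<alpha> d \<epsilon>))"

lemma sstring_reduces_sing:
  "d \<in> arr \<alpha> \<Longrightarrow> sstring_reduces P \<sigma> (sing \<alpha> d \<epsilon>) \<longleftrightarrow> reduces P \<sigma> (T_matrix \<alpha>) (mark_row \<alpha> d \<epsilon>)"
  by (simp add: sstring_reduces_def Abs_sstring_inverse)

lemma marking_mark_row:
  assumes "d \<in> arr \<alpha>"
  shows "marking (T_matrix \<alpha>) (mark_row \<alpha> d \<epsilon>)"
  unfolding marking_def
  by (rule bexI[of _ "Some d"]) (use assms in \<open>cases \<epsilon>; simp add: mark_row_def\<close>)+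

lemma mark_row_extension:
  assumes "\<And>g h. g \<in> insert None (Some ` arr \<alpha>) \<Longrightarrow> h \<in> insert None (Some ` arr \<alpha>) \<Longrightarrow> T_form \<beta> g h = T_form \<alpha> g h"
    and "d \<in> arr \<alpha>" "h \<in> insert None (Some ` arr \<alpha>)"
  shows "mark_row \<beta> d \<epsilon> h = mark_row \<alpha> d \<epsilon> h"
  using assms(1)[of "Some d" h] assms(1)[of None h] assms(2,3)
  by (cases \<epsilon>) (simp_all add: mark_row_def del: T_form.simps)

lemma sstring_reduces_relabel:
  assumes "arr \<beta> = map_prod \<eta> \<eta> ` arr \<alpha>" "inj_on (map_prod \<eta> \<eta>) (arr \<alpha>)"
    and T: "\<And>g h. g \<in> insert None (Some ` arr \<alpha>) \<Longrightarrow> h \<in> insert None (Some ` arr \<alpha>) \<Longrightarrow>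
      T_form \<beta> (map_option (map_prod \<eta> \<eta>) g) (map_option (map_prod \<eta> \<eta>) h) = T_form \<alpha> g h"
    and d: "d \<in> arr \<alpha>"
  shows "sstring_reduces P \<sigma> (sing \<alpha> d \<epsilon>) \<longleftrightarrow> sstring_reduces P \<sigma> (sing \<beta> (map_prod \<eta> \<eta> d) \<epsilon>)"
proof -
  let ?m = "map_option (map_prod \<eta> \<eta>)"
  have mark: "mark_row \<beta> (map_prod \<eta> \<eta> d) \<epsilon> (?m h) = mark_row \<alpha> d \<epsilon> h"
    if "h \<in> insert None (Some ` arr \<alpha>)" for h
    using T[of "Some d" h] T[of None h] that d by (cases \<epsilon>) (simp_all add: mark_row_def del: T_form.simps)
  have "inj_on ?m (insert None (Some ` arr \<alpha>))"
  proof (rule inj_onI)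
    fix g h assume gh: "g \<in> insert None (Some ` arr \<alpha>)" "h \<in> insert None (Some ` arr \<alpha>)" "?m g = ?m h"
    then have "set_option g \<subseteq> arr \<alpha>" "set_option h \<subseteq> arr \<alpha>" by auto
    then show "g = h"
      using option.inj_map_strong[OF _ gh(3)] inj_onD[OF assms(2)] by (meson subsetD)
  qed
  moreover have "?m ` insert None (Some ` arr \<alpha>) = insert None (Some ` arr \<beta>)"
    unfolding assms(1) by (simp add: image_image)
  ultimately have iso: "marked_iso ?m (T_matrix \<alpha>) (mark_row \<alpha> d \<epsilon>) (T_matrix \<beta>) (mark_row \<beta> (map_prod \<eta> \<eta> d) \<epsilon>)"
    unfolding marked_iso_def bij_betw_def using T mark by (simp del: T_form.simps)
  have d': "map_prod \<eta> \<eta> d \<in> arr \<beta>" using assms(1) d by blast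
  have "marked_iso (inv_into (elts (T_matrix \<alpha>)) ?m) (T_matrix \<beta>) (mark_row \<beta> (map_prod \<eta> \<eta> d) \<epsilon>)
      (T_matrix \<alpha>) (mark_row \<alpha> d \<epsilon>)"
    by (rule marked_iso_sym[OF iso]) simp
  then show ?thesis
    unfolding sstring_reduces_sing[OF d] sstring_reduces_sing[OF d']
    using reduces_iso iso T_matrix_based by metis
qed

text \<open>Each kind of move is an isomorphism of marked matrices or an elementary extension, except for the
  singular move of type 2, which changes neither the matrix nor the marked row.\<close>

lemma sstring_reduces_smove:
  assumes P: "irreducible_matrix P" and "smove X Y"
  shows "sstring_reduces P \<sigma> X \<longleftrightarrow> sstring_reduces P \<sigma> Y"
  using assms(2)
proof cases
  case (smove_homeo h \<beta> \<alpha> d \<epsilon>)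
  have "inj_on (map_prod h h) (circle \<times> circle)"
    using oriented_homeo_facts(1)[OF smove_homeo(3)] by (auto simp: inj_on_def)
  moreover have "arr \<alpha> \<subseteq> circle \<times> circle" using arr_circle by fastforce
  ultimately have inj: "inj_on (map_prod h h) (arr \<alpha>)" by (rule inj_on_subset)
  show ?thesis
    unfolding smove_homeo(1,2)
    by (rule sstring_reduces_relabel[OF smove_homeo(4) inj T_form_homeo[OF smove_homeo(3,4)] smove_homeo(5)])
next
  case (smove_type1 \<alpha> \<beta> d \<epsilon>)
  obtain e where e: "arr \<beta> = insert e (arr \<alpha>)" "e \<notin> arr \<alpha>" "removable (T_matrix \<beta>) {Some e}"
    using type1_removable[OF smove_type1(3)] .
  note T = T_form_type1[OF smove_type1(3)]
  have d: "d \<in> arr \<alpha>" "d \<in> arr \<beta>" using smove_type1(4) e by auto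
  show ?thesis
    unfolding smove_type1(1,2) sstring_reduces_sing[OF d(1)] sstring_reduces_sing[OF d(2)]
    by (rule reduces_extension_iff[OF P T_matrix_based marking_mark_row[OF d(1)]
          T_matrix_based marking_mark_row[OF d(2)] _ _ _ _ _ e(3)])
      (use e(1,2) T mark_row_extension[OF T d(1)] in \<open>auto simp del: T_form.simps\<close>)
next
  case (smove_type2 \<alpha> \<beta> d \<epsilon>)
  obtain e e' where e: "arr \<beta> = arr \<alpha> \<union> {e, e'}" "e \<notin> arr \<alpha>" "e' \<notin> arr \<alpha>"
    "removable (T_matrix \<beta>) {Some e, Some e'}"
    using type2_removable[OF smove_type2(3)] .
  note T = T_form_type2[OF smove_type2(3)]
  have d: "d \<in> arr \<alpha>" "d \<in> arr \<beta>" using smove_type2(4) e by auto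
  show ?thesis
    unfolding smove_type2(1,2) sstring_reduces_sing[OF d(1)] sstring_reduces_sing[OF d(2)]
    by (rule reduces_extension_iff[OF P T_matrix_based marking_mark_row[OF d(1)]
          T_matrix_based marking_mark_row[OF d(2)] _ _ _ _ _ e(4)])
      (use e(1,2,3) T mark_row_extension[OF T d(1)] in \<open>auto simp del: T_form.simps\<close>)
next
  case (smove_type3 \<alpha> R \<beta> d \<epsilon>)
  obtain \<tau> where \<tau>: "arr \<beta> = map_prod \<tau> \<tau> ` arr \<alpha>" "inj \<tau>"
    "\<forall>(e, e')\<in>R. e' = map_prod \<tau> \<tau> e" "\<forall>e\<in>arr \<alpha> - fst ` R. map_prod \<tau> \<tau> e = e"
    "\<forall>g\<in>insert None (Some ` arr \<alpha>). \<forall>h\<in>insert None (Some ` arr \<alpha>).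
      T_form \<beta> (map_option (map_prod \<tau> \<tau>) g) (map_option (map_prod \<tau> \<tau>) h) = T_form \<alpha> g h"
    using type3_swap[OF smove_type3(3)] .
  have inj: "inj_on (map_prod \<tau> \<tau>) (arr \<alpha>)" using \<tau>(2) by (auto simp: inj_on_def dest: injD)
  have "map_prod \<tau> \<tau> d = d" using \<tau>(4) smove_type3(4,5) by blast
  then show ?thesis
    using sstring_reduces_relabel[OF \<tau>(1) inj \<tau>(5)[rule_format] smove_type3(4), of P \<sigma> \<epsilon>] smove_type3(1,2) by simp
next
  case (smove_sing2 a a' x y b b' z w \<alpha> \<epsilon>)
  have "complementary (T_matrix \<alpha>) (Some (a, b)) (Some (b', a'))"
    by (rule parallel_complementary[OF smove_sing2(3-9)])
  then have "mark_row \<alpha> (b', a') (opp \<epsilon>) h = mark_row \<alpha> (a, b) \<epsilon> h" if "h \<in> elts (T_matrix \<alpha>)" for h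
    using that by (cases \<epsilon>) (auto simp: complementary_def mark_row_def algebra_simps simp del: T_form.simps)
  then have "marked_iso id (T_matrix \<alpha>) (mark_row \<alpha> (a, b) \<epsilon>) (T_matrix \<alpha>) (mark_row \<alpha> (b', a') (opp \<epsilon>))"
    "marked_iso id (T_matrix \<alpha>) (mark_row \<alpha> (b', a') (opp \<epsilon>)) (T_matrix \<alpha>) (mark_row \<alpha> (a, b) \<epsilon>)"
    by (simp_all add: marked_iso_def del: T_form.simps)
  then show ?thesis
    unfolding smove_sing2(1,2) sstring_reduces_sing[OF smove_sing2(8)] sstring_reduces_sing[OF smove_sing2(9)]
    using reduces_iso T_matrix_based by metis
next
  case (smove_sing3 \<alpha> R \<beta> d d' \<epsilon>)
  obtain \<tau> where \<tau>: "arr \<beta> = map_prod \<tau> \<tau> ` arr \<alpha>" "inj \<tau>"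
    "\<forall>(e, e')\<in>R. e' = map_prod \<tau> \<tau> e" "\<forall>e\<in>arr \<alpha> - fst ` R. map_prod \<tau> \<tau> e = e"
    "\<forall>g\<in>insert None (Some ` arr \<alpha>). \<forall>h\<in>insert None (Some ` arr \<alpha>).
      T_form \<beta> (map_option (map_prod \<tau> \<tau>) g) (map_option (map_prod \<tau> \<tau>) h) = T_form \<alpha> g h"
    using type3_swap[OF smove_sing3(3)] .
  have inj: "inj_on (map_prod \<tau> \<tau>) (arr \<alpha>)" using \<tau>(2) by (auto simp: inj_on_def dest: injD)
  have "d \<in> arr \<alpha>" using type3_facts(4)[OF smove_sing3(3)] smove_sing3(4) by force
  then show ?thesis
    using sstring_reduces_relabel[OF \<tau>(1) inj \<tau>(5)[rule_format], of d P \<sigma> \<epsilon>] smove_sing3(1,2)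
      bspec[OF \<tau>(3) smove_sing3(4)] by simp
qed

lemma sstring_reduces_homotopic:
  assumes P: "irreducible_matrix P" and h: "homotopic_sstrings X Y"
  shows "sstring_reduces P \<sigma> X \<longleftrightarrow> sstring_reduces P \<sigma> Y"
  using h unfolding homotopic_sstrings_def
proof (induction rule: equivclp_induct)
  case (step Y Z)
  then show ?case using sstring_reduces_smove[OF P] by blast
qed simp

lemma sstring_reduces_itself:
  assumes "d \<in> arr \<alpha>"
  shows "sstring_reduces (T_matrix \<alpha>) (mark_row \<alpha> d \<epsilon>) (sing \<alpha> d \<epsilon>)"
proof -
  have "marked_iso id (T_matrix \<alpha>) (mark_row \<alpha> d \<epsilon>) (T_matrix \<alpha>) (mark_row \<alpha> d \<epsilon>)"
    by (simp add: marked_iso_def)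
  then show ?thesis
    unfolding sstring_reduces_sing[OF assms]
    using reduces.iso T_matrix_based marking_mark_row[OF assms] by blast
qed

text \<open>Pull the vanishing of the marked row, or its equality with the row of \<open>s\<close>, back along the embedding
  of the primitive matrix.\<close>

lemma primitive_class_not_semi_trivial:
  assumes prim: "primitive (T_matrix \<alpha>)" and e: "e \<in> arr \<alpha>"
  shows "\<not> semi_trivial_class (sstring_class (sing \<alpha> e \<epsilon>))"
proof
  let ?P = "T_matrix \<alpha>"
  assume "semi_trivial_class (sstring_class (sing \<alpha> e \<epsilon>))"
  then obtain X where X: "homotopic_sstrings (sing \<alpha> e \<epsilon>) X" "semi_trivial_sstring X"
    by (auto simp: semi_trivial_class_def sstring_class_def)
  note irr = primitive_irreducible[OF prim]
  have no: "\<not> annihilating ?P (Some e)" "\<not> core ?P (Some e)"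
    using irr unfolding irreducible_matrix_def removable_def by blast+
  obtain \<beta> a b \<epsilon>' where XX: "Rep_sstring X = (\<beta>, (a, b), \<epsilon>')" by (metis prod.exhaust)
  have d: "(a, b) \<in> arr \<beta>" using Rep_sstring[of X] XX by simp
  have "sstring_reduces ?P (mark_row \<alpha> e \<epsilon>) X"
    using sstring_reduces_homotopic[OF irr X(1)] sstring_reduces_itself[OF e] by blast
  then have r: "reduces ?P (mark_row \<alpha> e \<epsilon>) (T_matrix \<beta>) (mark_row \<beta> (a, b) \<epsilon>')"
    by (simp add: sstring_reduces_def XX)
  have "annihilating (T_matrix \<beta>) (Some (a, b)) \<or> core (T_matrix \<beta>) (Some (a, b))"
    using X(2) free_arc_annihilating[OF d] free_arc_core[OF d] by (auto simp: semi_trivial_sstring_def XX)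
  then have "(\<forall>h\<in>elts (T_matrix \<beta>). mark_row \<beta> (a, b) \<epsilon>' h = 0) \<or>
    (\<forall>h\<in>elts (T_matrix \<beta>). mark_row \<beta> (a, b) \<epsilon>' h = form (T_matrix \<beta>) (base (T_matrix \<beta>)) h)"
    unfolding annihilating_def core_def by (cases \<epsilon>') (auto simp: mark_row_def simp del: T_form.simps)
  then have "(\<forall>h\<in>elts ?P. mark_row \<alpha> e \<epsilon> h = 0) \<or>
    (\<forall>h\<in>elts ?P. mark_row \<alpha> e \<epsilon> h = form ?P (base ?P) h)"
    using reduces_trivial_mark[OF r] by auto
  then have "annihilating ?P (Some e) \<or> core ?P (Some e)"
    using e unfolding annihilating_def core_def by (cases \<epsilon>) (auto simp: mark_row_def simp del: T_form.simps)
  with no show False by blast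
qed

lemma primitive_opposite_classes:
  assumes prim: "primitive (T_matrix \<alpha>)" and e: "e \<in> arr \<alpha>" and f: "f \<in> arr \<alpha>"
    and eq: "sstring_class (sing \<alpha> e Plus) = sstring_class (sing \<alpha> f Minus)"
  shows "e = f" "self_complementary (T_matrix \<alpha>) (Some e)"
proof -
  let ?P = "T_matrix \<alpha>"
  have irr: "irreducible_matrix ?P" using primitive_irreducible[OF prim] .
  have "sing \<alpha> f Minus \<in> sstring_class (sing \<alpha> e Plus)"
    unfolding eq by (simp add: sstring_class_def homotopic_sstrings_def)
  then have "homotopic_sstrings (sing \<alpha> e Plus) (sing \<alpha> f Minus)" by (simp add: sstring_class_def)
  then have "sstring_reduces ?P (mark_row \<alpha> e Plus) (sing \<alpha> f Minus)"
    using sstring_reduces_homotopic[OF irr] sstring_reduces_itself[OF e] by blast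
  moreover have "mark_row \<alpha> e Plus = form ?P (Some e)"
    "mark_row \<alpha> f Minus = (\<lambda>h. form ?P (base ?P) h - form ?P (Some f) h)"
    by (simp_all add: fun_eq_iff mark_row_def)
  ultimately have "reduces ?P (form ?P (Some e)) ?P (\<lambda>h. form ?P (base ?P) h - form ?P (Some f) h)"
    using sstring_reduces_sing[OF f] by metis
  then have "Some e = Some f \<and> self_complementary ?P (Some e)"
    using e f by (intro irreducible_opposite_signs[OF irr]) simp_all
  then show "e = f" "self_complementary ?P (Some e)" by auto
qed

section \<open>Counting terms\<close>

lemma num_terms_superset:
  assumes "finite K" "Poly_Mapping.keys L \<subseteq> K"
  shows "num_terms L = (\<Sum>k\<in>K. \<bar>Poly_Mapping.lookup L k\<bar>)"
  unfolding num_terms_def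
  by (rule sum.mono_neutral_left) (use assms in \<open>auto simp: in_keys_iff\<close>)

lemma num_terms_diff_le: "num_terms (L - L') \<le> num_terms L + num_terms L'"
proof -
  let ?K = "Poly_Mapping.keys L \<union> Poly_Mapping.keys L'"
  have k: "Poly_Mapping.keys (L - L') \<subseteq> ?K" by (rule keys_diff)
  have "num_terms (L - L') = (\<Sum>k\<in>?K. \<bar>Poly_Mapping.lookup L k - Poly_Mapping.lookup L' k\<bar>)"
    using num_terms_superset[OF _ k] by (simp add: lookup_minus)
  also have "\<dots> \<le> (\<Sum>k\<in>?K. \<bar>Poly_Mapping.lookup L k\<bar> + \<bar>Poly_Mapping.lookup L' k\<bar>)"
    by (rule sum_mono) simp
  also have "\<dots> = num_terms L + num_terms L'"
    by (simp add: sum.distrib num_terms_superset[of ?K])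
  finally show ?thesis .
qed

lemma num_terms_add_le: "num_terms (L + L') \<le> num_terms L + num_terms L'"
proof -
  have "num_terms (- L') = num_terms L'" by (simp add: num_terms_def)
  then show ?thesis using num_terms_diff_le[of L "- L'"] by simp
qed

lemma num_terms_gen_le: "num_terms (gen C) \<le> 1"
  by (simp add: gen_def num_terms_def )

lemma num_terms_mu_string_le: "num_terms (mu_string \<alpha>) \<le> 2 * int (card (arr \<alpha>))"
proof -
  have "num_terms (\<Sum>e\<in>A. gen (c e) - gen (d e)) \<le> 2 * int (card A)" if "finite A" for A :: "arrow set" and c d
    using that
  proof induction
    case (insert e A)
    have "num_terms (gen (c e) - gen (d e)) \<le> 2"
      using num_terms_diff_le[of "gen (c e)" "gen (d e)"] num_terms_gen_le[of "c e"] num_terms_gen_le[of "d e"]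
      by linarith
    then show ?case
      using insert num_terms_add_le[of "gen (c e) - gen (d e)" "\<Sum>e\<in>A. gen (c e) - gen (d e)"] by simp
  qed (simp add: num_terms_def)
  then show ?thesis unfolding mu_string_def by simp
qed

text \<open>Several \<open>c e\<close> may coincide, but equal terms then add up with the same sign.\<close>

lemma num_terms_no_cancellation:
  assumes fin: "finite A" and disj: "c ` A \<inter> d ` A = {}"
  shows "num_terms (\<Sum>e\<in>A. frag_of (c e) - frag_of (d e)) = 2 * int (card A)"
    (is "num_terms ?L = _")
proof -
  have count: "(\<Sum>e\<in>A. of_bool (f e = k)) = int (card {e \<in> A. f e = k})" for f :: "'a \<Rightarrow> 'b" and k
    using fin by (simp add: Int_def)
  have look: "Poly_Mapping.lookup ?L k = int (card {e \<in> A. c e = k}) - int (card {e \<in> A. d e = k})" for k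
    unfolding count[symmetric]
    by (simp add: lookup_sum lookup_minus  lookup_single when_def of_bool_def sum_subtractf eq_commute[of k])
  have k: "Poly_Mapping.keys ?L \<subseteq> c ` A \<union> d ` A"
  proof
    fix k assume "k \<in> Poly_Mapping.keys ?L"
    then have "Poly_Mapping.lookup ?L k \<noteq> 0" by (simp add: in_keys_iff)
    then have "{e \<in> A. c e = k} \<noteq> {} \<or> {e \<in> A. d e = k} \<noteq> {}" unfolding look by (metis card.empty diff_self)
    then show "k \<in> c ` A \<union> d ` A" by blast
  qed
  have total: "(\<Sum>k\<in>f ` A. int (card {e \<in> A. f e = k})) = int (card A)" for f :: "'a \<Rightarrow> 'b"
    using sum.image_gen[OF fin, of "\<lambda>_. 1 :: int" f] by simp
  have "num_terms ?L = (\<Sum>k\<in>c ` A \<union> d ` A. \<bar>Poly_Mapping.lookup ?L k\<bar>)"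
    using fin k by (intro num_terms_superset) auto
  also have "\<dots> = (\<Sum>k\<in>c ` A. \<bar>Poly_Mapping.lookup ?L k\<bar>) + (\<Sum>k\<in>d ` A. \<bar>Poly_Mapping.lookup ?L k\<bar>)"
    using fin disj by (intro sum.union_disjoint) auto
  also have "(\<Sum>k\<in>c ` A. \<bar>Poly_Mapping.lookup ?L k\<bar>) = (\<Sum>k\<in>c ` A. int (card {e \<in> A. c e = k}))"
  proof (intro sum.cong refl)
    fix k assume "k \<in> c ` A"
    then have none: "{e \<in> A. d e = k} = {}" using disj by blast
    show "\<bar>Poly_Mapping.lookup ?L k\<bar> = int (card {e \<in> A. c e = k})" unfolding look none by simp
  qed
  also have "(\<Sum>k\<in>d ` A. \<bar>Poly_Mapping.lookup ?L k\<bar>) = (\<Sum>k\<in>d ` A. int (card {e \<in> A. d e = k}))"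
  proof (intro sum.cong refl)
    fix k assume "k \<in> d ` A"
    then have none: "{e \<in> A. c e = k} = {}" using disj by blast
    show "\<bar>Poly_Mapping.lookup ?L k\<bar> = int (card {e \<in> A. d e = k})" unfolding look none by simp
  qed
  finally show ?thesis unfolding total by simp
qed

lemma half_num_terms_le_min:
  "num_terms (mu_string \<alpha>) \<le> 2 * int (min_self_intersection (string_class \<alpha>))"
  "min_self_intersection (string_class \<alpha>) \<le> card (arr \<alpha>)"
proof -
  let ?Q = "\<lambda>n. \<exists>\<beta>\<in>string_class \<alpha>. n = card (arr \<beta>)"
  have self: "\<alpha> \<in> string_class \<alpha>" by (simp add: string_class_def)
  then have Q: "?Q (card (arr \<alpha>))" by blast
  then have "?Q (min_self_intersection (string_class \<alpha>))"
    unfolding min_self_intersection_def by (rule LeastI)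
  then obtain \<beta> where \<beta>: "homotopic_strings \<alpha> \<beta>" "min_self_intersection (string_class \<alpha>) = card (arr \<beta>)"
    by (auto simp: string_class_def)
  show "num_terms (mu_string \<alpha>) \<le> 2 * int (min_self_intersection (string_class \<alpha>))"
    using num_terms_mu_string_le[of \<beta>] mu_string_homotopic[OF \<beta>(1)] \<beta>(2) by simp
  show "min_self_intersection (string_class \<alpha>) \<le> card (arr \<alpha>)"
    unfolding min_self_intersection_def using Q by (rule Least_le)
qed

text \<open>The case \<open>2n - 2\<close> occurs if the two terms of an arrow \<open>e\<close> cancel each other. By uniqueness of the
  self-complementary arrow there is no further cancellation.\<close>

lemma num_terms_primitive:
  assumes prim: "primitive (T_matrix \<alpha>)"
  shows "num_terms (mu_string \<alpha>) = 2 * int (card (arr \<alpha>)) \<or>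
    (\<exists>g. self_complementary (T_matrix \<alpha>) g) \<and> num_terms (mu_string \<alpha>) = 2 * int (card (arr \<alpha>)) - 2"
proof -
  let ?c = "\<lambda>e. sstring_class (sing \<alpha> e Plus)" and ?d = "\<lambda>e. sstring_class (sing \<alpha> e Minus)"
  have mu: "mu_string \<alpha> = (\<Sum>e\<in>arr \<alpha>. frag_of (?c e) - frag_of (?d e))"
    unfolding mu_string_def gen_def
    by (intro sum.cong refl) (simp add: primitive_class_not_semi_trivial[OF prim])
  show ?thesis
  proof (cases "\<exists>e\<in>arr \<alpha>. ?c e = ?d e")
    case False
    then have "?c ` arr \<alpha> \<inter> ?d ` arr \<alpha> = {}" using primitive_opposite_classes(1)[OF prim] by blast
    then show ?thesis unfolding mu using num_terms_no_cancellation[OF finite_arr] by blast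
  next
    case True
    then obtain e where e: "e \<in> arr \<alpha>" "?c e = ?d e" by blast
    let ?B = "arr \<alpha> - {e}"
    have self: "self_complementary (T_matrix \<alpha>) (Some e)"
      using primitive_opposite_classes(2)[OF prim e(1,1,2)] .
    have "?c f \<noteq> ?d g" if "f \<in> ?B" "g \<in> ?B" for f g
    proof
      assume "?c f = ?d g"
      then have "self_complementary (T_matrix \<alpha>) (Some f)"
        using primitive_opposite_classes(2)[OF prim, of f g] that by blast
      then have "Some e = Some f"
        by (intro self_complementary_unique[OF primitive_irreducible[OF prim] self]) simp_all
      then show False using that by simp
    qed
    then have "?c ` ?B \<inter> ?d ` ?B = {}" by blast
    from num_terms_no_cancellation[OF _ this] have B: "num_terms (\<Sum>e\<in>?B. frag_of (?c e) - frag_of (?d e)) = 2 * int (card ?B)"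
      by simp
    have "mu_string \<alpha> = (\<Sum>e\<in>?B. frag_of (?c e) - frag_of (?d e))"
      unfolding mu using e by (simp add: sum.remove)
    moreover have "int (card ?B) = int (card (arr \<alpha>)) - 1"
      using e(1) by (simp add: card_Diff_singleton) (metis One_nat_def Suc_leI card_gt_0_iff empty_iff finite_arr of_nat_1 of_nat_diff)
    ultimately show ?thesis using B self by auto
  qed
qed

theorem theorem1p1:
  fixes \<alpha> :: vstring
  assumes "primitive (T_matrix \<alpha>)"
  shows "(\<not> (\<exists>g. self_complementary (T_matrix \<alpha>) g) \<longrightarrow>
            real (min_self_intersection (string_class \<alpha>))
              = real_of_int (num_terms (mu (string_class \<alpha>))) / 2) \<and>
         ((\<exists>g. self_complementary (T_matrix \<alpha>) g) \<longrightarrow>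
            real (min_self_intersection (string_class \<alpha>))
              = real_of_int (num_terms (mu (string_class \<alpha>))) / 2 \<or>
            real (min_self_intersection (string_class \<alpha>))
              = real_of_int (num_terms (mu (string_class \<alpha>))) / 2 + 1)"
proof -
  define t m n where "t = num_terms (mu_string \<alpha>)" and "m = min_self_intersection (string_class \<alpha>)"
    and "n = card (arr \<alpha>)"
  have le: "t \<le> 2 * int m" "m \<le> n" using half_num_terms_le_min[of \<alpha>] by (simp_all add: t_def m_def n_def)
  from num_terms_primitive[OF assms]
  consider "t = 2 * int n" | "\<exists>g. self_complementary (T_matrix \<alpha>) g" "t = 2 * int n - 2"
    unfolding t_def n_def by blast
  then have "real m = real_of_int t / 2 \<or>
    (\<exists>g. self_complementary (T_matrix \<alpha>) g) \<and> real m = real_of_int t / 2 + 1"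
  proof cases
    case 1
    then show ?thesis using le by simp
  next
    case 2
    then have "n = m \<or> n = Suc m" using le by linarith
    then have "real m = real_of_int t / 2 + 1 \<or> real m = real_of_int t / 2"
      unfolding \<open>t = 2 * int n - 2\<close> by (auto simp: field_simps)
    then show ?thesis using 2(1) by blast
  qed
  moreover have "num_terms (mu (string_class \<alpha>)) = t" by (simp add: mu_string_class t_def)
  ultimately show ?thesis unfolding m_def by auto
qed

end
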